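(* Let $j\ge1$ be an integer and $a\in\mathbb{C}$. Put $D=1-aS_{j+1}(-x-y)-aS_1(x+y)S_j(-x-y)$. Then in $\mathbb{C}[[x,y]]$ $$\exp(a\varphi_{-j}\varphi^*_{-1})\cdot1=\frac1D\exp\left(-\sum_{n\ge1}\sum_{0\le i\le n}\frac{\binom{n}{i}S_1(x+y)^{n-i}(n+i)x_{n+i}}{n}\left(\frac{-aS_{j-1}(-x-y)}{D}\right)^n\right).$$
   Context: Let $x=(x_1,x_2,\dots)$, $y=(y_1,y_2,\dots)$ and $p$ be formal variables and let $\mathcal{B}=\mathbb{C}[[x,y;p,p^{-1}]]$ be the (completed) bosonic Fock space. Write $\partial x_n=\partial/\partial x_n$, $\partial y_n=\partial/\partial y_n$, $\partial p=\partial/\partial p$. The operators $\varphi_i,\varphi^*_i$ ($i\in\mathbb{Z}$) on $\mathcal{B}$ are defined by the generating series $\varphi(z)=\sum_{i\in\mathbb{Z}}\varphi_iz^{-i-1}$ and $\varphi^*(z)=\sum_{i\in\mathbb{Z}}\varphi^*_iz^{-i}$, where $$\varphi^{*}(z)=p\exp\Big(\sum_{n>0}(x_n+y_n)z^n\Big)\Big(\sum_{k>0}kx_kz^{k-1}+\sum_{k>0}\partial x_k\,z^{-k-1}+p\,\partial p\,z^{-1}\Big)\exp\Big(-\sum_{n>0}(\partial x_n-\partial y_n)\tfrac{z^{-n}}{n}\Big),$$ $$\varphi(z)=p^{-1}\exp\Big(-\sum_{n>0}(x_n+y_n)z^n\Big)\exp\Big(\sum_{n>0}(\partial x_n-\partial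 y_n)\tfrac{z^{-n}}{n}\Big).$$ They satisfy $[\varphi_i,\varphi^*_j]=\delta_{i,-j}$, $[\varphi_i,\varphi_j]=[\varphi^*_i,\varphi^*_j]=0$, and $1\in\mathcal{B}$ is a vacuum vector: $\varphi_i\cdot1=\varphi^*_{i+1}\cdot1=0$ for $i\ge0$. For a sequence $t=(t_1,t_2,\dots)$ the elementary Schur polynomials $S_k(t)$ are defined by $\sum_{k\ge0}S_k(t)w^k=\exp(\sum_{n\ge1}t_nw^n)$ (and $S_k=0$ for $k<0$); $S_k(x+y)$ and $S_k(-x-y)$ are the values at $t_n=x_n+y_n$ and $t_n=-x_n-y_n$. The operator exponential is the usual power series applied to $1$; it converges coefficientwise in $\mathbb{C}[[x,y]]$. Inverses of power series with constant term $1$ are taken in $\mathbb{C}[[x,y]]$. *)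

theory Defs
  imports
    "HOL-Analysis.Analysis"
    "HOL-Library.Poly_Mapping"
    "HOL-Computational_Algebra.Formal_Power_Series"
begin

section \<open>The power series ring in two infinite families of variables\<close>

text \<open>
  The indices are shifted: \<open>Xvar n\<close> and \<open>Yvar n\<close> name the variables $x_{n+1}$ and $y_{n+1}$.
\<close>

datatype var = Xvar nat | Yvar nat

type_synonym monom = "var \<Rightarrow>\<^sub>0 nat"

text \<open>
  A series is an arbitrary family of complex coefficients indexed by all monomials; in particular
  the variables themselves may be summed with arbitrary weights.
\<close>

typedef mps = "UNIV :: (monom \<Rightarrow> complex) set"
  morphisms mps_coeff Abs_mps ..

setup_lifting type_definition_mps

lemma mps_eqI: "(\<And>m. mps_coeff f m = mps_coeff g m) \<Longrightarrow> f = g"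
  by (simp add: mps_coeff_inject[symmetric] fun_eq_iff)

definition decomps :: "monom \<Rightarrow> (monom \<times> monom) set" where
  "decomps m = {(a, b). a + b = m}"

lemma finite_decomps: "finite (decomps m)"
proof -
  define N where "N = (\<Sum>v\<in>Poly_Mapping.keys m. Poly_Mapping.lookup m v)"
  let ?S = "{f :: var \<Rightarrow> nat. \<forall>v. (v \<in> Poly_Mapping.keys m \<longrightarrow> f v \<in> {..N}) \<and> (v \<notin> Poly_Mapping.keys m \<longrightarrow> f v = 0)}"
  have fin: "finite (Poly_Mapping.lookup -` ?S)"
    by (rule finite_vimageI[OF finite_set_of_finite_funs])
      (simp_all add: inj_on_def poly_mapping.lookup_inject)
  have bound: "a \<in> Poly_Mapping.lookup -` ?S" if "a + b = m" for a b :: monom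
  proof -
    have le: "Poly_Mapping.lookup a v \<le> Poly_Mapping.lookup m v" for v
      using that by (auto simp: lookup_add)
    have "Poly_Mapping.lookup m v \<le> N" if "v \<in> Poly_Mapping.keys m" for v
      unfolding N_def by (rule member_le_sum) (use that in auto)
    with le show ?thesis
      by (auto simp: in_keys_iff intro: le_trans) (metis le le_zero_eq)
  qed
  have "decomps m \<subseteq> (Poly_Mapping.lookup -` ?S) \<times> (Poly_Mapping.lookup -` ?S)"
  proof
    fix p assume "p \<in> decomps m"
    then obtain a b where p: "p = (a, b)" and ab: "a + b = m"
      by (auto simp: decomps_def)
    from ab have "b + a = m" by (simp add: add.commute)
    with bound[OF ab] bound show "p \<in> (Poly_Mapping.lookup -` ?S) \<times> (Poly_Mapping.lookup -` ?S)"
      unfolding p by blast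
  qed
  then show ?thesis
    using fin by (meson finite_SigmaI finite_subset)
qed

instantiation mps :: comm_ring_1
begin

lift_definition zero_mps :: mps is "\<lambda>_. 0" .
lift_definition one_mps :: mps is "\<lambda>m. if m = 0 then 1 else 0" .
lift_definition plus_mps :: "mps \<Rightarrow> mps \<Rightarrow> mps" is "\<lambda>f g m. f m + g m" .
lift_definition minus_mps :: "mps \<Rightarrow> mps \<Rightarrow> mps" is "\<lambda>f g m. f m - g m" .
lift_definition uminus_mps :: "mps \<Rightarrow> mps" is "\<lambda>f m. - f m" .
lift_definition times_mps :: "mps \<Rightarrow> mps \<Rightarrow> mps"
  is "\<lambda>f g m. \<Sum>(a, b)\<in>decomps m. f a * g b" .

lemmas mps_coeff_simps = zero_mps.rep_eq one_mps.rep_eq plus_mps.rep_eq minus_mps.rep_eq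
  uminus_mps.rep_eq times_mps.rep_eq

instance
proof
  fix f g h :: mps
  show "f + g + h = f + (g + h)" "f + g = g + f" "0 + f = f" "- f + f = 0" "f - g = f + - g"
    by (rule mps_eqI, simp add: mps_coeff_simps)+
  show "f * g = g * f"
  proof (rule mps_eqI)
    fix m
    have "(\<Sum>p\<in>decomps m. mps_coeff f (fst p) * mps_coeff g (snd p))
        = (\<Sum>p\<in>decomps m. mps_coeff g (fst p) * mps_coeff f (snd p))"
      by (rule sum.reindex_bij_witness[where i = prod.swap and j = prod.swap])
        (auto simp: decomps_def add.commute mult.commute)
    then show "mps_coeff (f * g) m = mps_coeff (g * f) m"
      by (simp add: mps_coeff_simps case_prod_unfold)
  qed
  show "(f + g) * h = f * h + g * h"
    by (rule mps_eqI) (simp add: mps_coeff_simps algebra_simps sum.distrib case_prod_unfold)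
  show "1 * f = f"
  proof (rule mps_eqI)
    fix m
    have "mps_coeff (1 * f) m
        = (\<Sum>p\<in>decomps m. if p = (0, m) then mps_coeff f m else 0)"
      unfolding mps_coeff_simps by (rule sum.cong) (auto simp: decomps_def split: if_splits)
    also have "\<dots> = mps_coeff f m"
      using finite_decomps[of m] by (simp add: decomps_def)
    finally show "mps_coeff (1 * f) m = mps_coeff f m" .
  qed
  show "f * g * h = f * (g * h)"
  proof (rule mps_eqI)
    fix m
    let ?F = "mps_coeff f" and ?G = "mps_coeff g" and ?H = "mps_coeff h"
    have "mps_coeff (f * g * h) m
        = (\<Sum>q\<in>decomps m. \<Sum>r\<in>decomps (fst q). ?F (fst r) * ?G (snd r) * ?H (snd q))"
      by (simp add: mps_coeff_simps sum_distrib_right case_prod_unfold)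
    also have "\<dots> = (\<Sum>s\<in>(SIGMA q:decomps m. decomps (fst q)).
        ?F (fst (snd s)) * ?G (snd (snd s)) * ?H (snd (fst s)))"
      by (subst sum.Sigma) (simp_all add: finite_decomps case_prod_unfold)
    also have "\<dots> = (\<Sum>s\<in>(SIGMA q:decomps m. decomps (snd q)).
        ?F (fst (fst s)) * (?G (fst (snd s)) * ?H (snd (snd s))))"
      by (rule sum.reindex_bij_witness[where
            i = "\<lambda>s. ((fst (fst s) + fst (snd s), snd (snd s)), (fst (fst s), fst (snd s)))" and
            j = "\<lambda>s. ((fst (snd s), snd (snd s) + snd (fst s)), (snd (snd s), snd (fst s)))"])
        (auto simp: decomps_def add.assoc mult.assoc)
    also have "\<dots> = (\<Sum>q\<in>decomps m. \<Sum>r\<in>decomps (snd q).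
        ?F (fst q) * (?G (fst r) * ?H (snd r)))"
      by (subst sum.Sigma) (simp_all add: finite_decomps case_prod_unfold)
    also have "\<dots> = mps_coeff (f * (g * h)) m"
      by (simp add: mps_coeff_simps sum_distrib_left case_prod_unfold)
    finally show "mps_coeff (f * g * h) m = mps_coeff (f * (g * h)) m" .
  qed
  have "mps_coeff 0 0 \<noteq> mps_coeff 1 0"
    by (simp add: mps_coeff_simps)
  then show "(0::mps) \<noteq> 1"
    by metis
qed

end

text \<open>
  Division by non-units takes the junk value 0.
\<close>

instantiation mps :: inverse
begin

definition inverse_mps :: "mps \<Rightarrow> mps" where
  "inverse f = (if f dvd 1 then (THE g. f * g = 1) else 0)" for f :: mps

definition divide_mps :: "mps \<Rightarrow> mps \<Rightarrow> mps" where
  "f div g = f * inverse g" for f g :: mps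

instance ..

end

lemma mps_inverse_unique:
  fixes f g :: mps
  assumes "f * g = 1"
  shows "inverse f = g"
proof -
  have "h = g" if h: "f * h = 1" for h
  proof -
    have "h = (f * g) * h"
      using assms by simp
    also have "\<dots> = g * (f * h)"
      by (simp only: ac_simps)
    finally show ?thesis
      using h by simp
  qed
  then have "(THE h. f * h = 1) = g"
    using assms by (rule the_equality[rotated])
  moreover have "f dvd 1"
    using assms by (rule dvdI[OF sym])
  ultimately show ?thesis
    by (simp add: inverse_mps_def)
qed

text \<open>
  The topology of coefficientwise convergence, used for all infinite sums of series below.
\<close>

instantiation mps :: t2_space
begin

definition open_mps :: "mps set \<Rightarrow> bool" where
  "open U \<longleftrightarrow> open (mps_coeff ` U)"

instance
proof
  have inj: "inj mps_coeff"
    by (simp add: inj_on_def mps_coeff_inject)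
  have surj: "range mps_coeff = UNIV"
    by (metis Abs_mps_inverse UNIV_I surjI)
  show "open (UNIV :: mps set)"
    by (simp add: open_mps_def surj)
  show "open (S \<inter> T)" if "open S" "open T" for S T :: "mps set"
    using that by (simp add: open_mps_def image_Int[OF inj] open_Int)
  show "open (\<Union>K)" if "\<forall>S\<in>K. open S" for K :: "mps set set"
    using that unfolding open_mps_def image_Union by (intro open_UN) simp
  show "\<exists>U V. open U \<and> open V \<and> f \<in> U \<and> g \<in> V \<and> U \<inter> V = {}"
    if neq: "f \<noteq> g" for f g :: mps
  proof -
    have "\<exists>m. mps_coeff f m \<noteq> mps_coeff g m"
      using neq mps_eqI[of f g] by auto
    then obtain m where m: "mps_coeff f m \<noteq> mps_coeff g m"
      by blast
    from hausdorff[OF m] obtain A B where AB: "open A" "open B" "mps_coeff f m \<in> A" "mps_coeff g m \<in> B" "A \<inter> B = {}"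
      by blast
    have op: "open {h. mps_coeff h m \<in> W}" if "open W" for W
    proof -
      have "mps_coeff ` {h. mps_coeff h m \<in> W} = (\<lambda>u. u m) -` W"
      proof (intro set_eqI iffI)
        fix u assume "u \<in> (\<lambda>u. u m) -` W"
        then show "u \<in> mps_coeff ` {h. mps_coeff h m \<in> W}"
          by (intro image_eqI[of _ _ "Abs_mps u"]) (simp_all add: Abs_mps_inverse)
      qed auto
      moreover have "open ((\<lambda>u :: monom \<Rightarrow> complex. u m) -` W)"
        by (intro open_vimage[OF that] continuous_on_product_coordinates)
      ultimately show ?thesis
        by (simp add: open_mps_def)
    qed
    show ?thesis
      by (rule exI[of _ "{h. mps_coeff h m \<in> A}"], rule exI[of _ "{h. mps_coeff h m \<in> B}"])
        (use AB op in auto)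
  qed
qed

end

lift_definition mps_const :: "complex \<Rightarrow> mps" is "\<lambda>c m. if m = 0 then c else 0" .

lift_definition mps_var :: "var \<Rightarrow> mps"
  is "\<lambda>v m. if m = Poly_Mapping.single v 1 then 1 else 0" .

lift_definition mps_deriv :: "var \<Rightarrow> mps \<Rightarrow> mps"
  is "\<lambda>v f m. of_nat (Poly_Mapping.lookup m v + 1) * f (m + Poly_Mapping.single v 1)" .

text \<open>
  The following are meant for indices \<open>n \<ge> 1\<close> only.
\<close>

definition xv :: "nat \<Rightarrow> mps" where "xv n = mps_var (Xvar (n - 1))"
definition yv :: "nat \<Rightarrow> mps" where "yv n = mps_var (Yvar (n - 1))"
definition dx :: "nat \<Rightarrow> mps \<Rightarrow> mps" where "dx n = mps_deriv (Xvar (n - 1))"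
definition dy :: "nat \<Rightarrow> mps \<Rightarrow> mps" where "dy n = mps_deriv (Yvar (n - 1))"

definition mps_exp :: "mps \<Rightarrow> mps" where
  "mps_exp f = suminf (\<lambda>m. mps_const (1 / fact m) * f ^ m)"

text \<open>
  The coefficient of $w^k$ in $\exp(\sum_{n\ge1} t_n w^n)$.  The sum over the exponent \<open>m\<close> of the
  exponential series stops at \<open>k\<close> since the $m$-th power is divisible by $w^m$.
\<close>

definition schur :: "nat \<Rightarrow> (nat \<Rightarrow> mps) \<Rightarrow> mps" where
  "schur k t = (\<Sum>m\<le>k. mps_const (1 / fact m) *
     fps_nth (Abs_fps (\<lambda>n. if n = 0 then 0 else t n) ^ m) k)"


section \<open>The bosonic Fock space\<close>

text \<open>
  \<open>f n\<close> is the coefficient of $p^n$.  Products with elements of \<^typ>\<open>mps\<close>, derivatives and limits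
  are all taken separately for each power of \<open>p\<close>.
\<close>

type_synonym fock = "int \<Rightarrow> mps"

definition of_mps :: "mps \<Rightarrow> fock" where
  "of_mps g = (\<lambda>n. if n = 0 then g else 0)"

definition vac :: fock where
  "vac = of_mps 1"

definition fmult :: "mps \<Rightarrow> fock \<Rightarrow> fock" where
  "fmult g f = (\<lambda>n. g * f n)"

definition pshift :: "int \<Rightarrow> fock \<Rightarrow> fock" \<comment> \<open>multiplication by $p^k$\<close> where
  "pshift k f = (\<lambda>n. f (n - k))"

definition op_exp :: "(fock \<Rightarrow> fock) \<Rightarrow> fock \<Rightarrow> fock" where
  "op_exp T f = (\<lambda>n. suminf (\<lambda>m. mps_const (1 / fact m) * (T ^^ m) f n))"


section \<open>Operator-valued formal Laurent series\<close>

text \<open>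
  \<open>A i\<close> is the coefficient of $z^i$ in $A(z)$.
\<close>

type_synonym opseries = "int \<Rightarrow> fock \<Rightarrow> fock"

definition opser_one :: opseries where
  "opser_one i f = (if i = 0 then f else (\<lambda>n. 0))"

definition opser_mult :: "opseries \<Rightarrow> opseries \<Rightarrow> opseries" (infixr \<open>\<odot>\<close> 70) where
  "(A \<odot> B) i f = (\<lambda>n. \<Sum>\<^sub>\<infinity>k. A k (B (i - k) f) n)"

definition opser_exp :: "opseries \<Rightarrow> opseries" where
  "opser_exp A i f = (\<lambda>n. suminf (\<lambda>m. mps_const (1 / fact m) * ((\<lambda>B. A \<odot> B) ^^ m) opser_one i f n))"

definition opser_uminus :: "opseries \<Rightarrow> opseries" where
  "opser_uminus A i f = (\<lambda>n. - A i f n)"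

definition creation :: opseries \<comment> \<open>$\sum_{n>0}(x_n+y_n)z^n$\<close> where
  "creation i f = (if i > 0 then fmult (xv (nat i) + yv (nat i)) f else (\<lambda>n. 0))"

definition annihilation :: opseries \<comment> \<open>$\sum_{n>0}(\partial x_n-\partial y_n)z^{-n}/n$\<close> where
  "annihilation i f = (\<lambda>n. if i < 0
     then mps_const (1 / of_int (- i)) * (dx (nat (- i)) (f n) - dy (nat (- i)) (f n)) else 0)"

definition current :: opseries
  \<comment> \<open>$\sum_{k>0} k x_k z^{k-1}+\sum_{k>0}\partial x_k z^{-k-1}+p\,\partial p\,z^{-1}$\<close> where
  "current i f = (\<lambda>n.
     if i \<ge> 0 then of_int (i + 1) * xv (nat (i + 1)) * f n
     else if i = -1 then of_int n * f n
     else dx (nat (- i - 1)) (f n))"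

definition phi_star_series :: opseries where
  "phi_star_series i f =
     pshift 1 ((opser_exp creation \<odot> current \<odot> opser_exp (opser_uminus annihilation)) i f)"

definition phi_series :: opseries where
  "phi_series i f =
     pshift (-1) ((opser_exp (opser_uminus creation) \<odot> opser_exp annihilation) i f)"

text \<open>
  The conventions are $\varphi(z)=\sum_i\varphi_iz^{-i-1}$ and $\varphi^*(z)=\sum_i\varphi^*_iz^{-i}$.
\<close>

definition phi :: "int \<Rightarrow> fock \<Rightarrow> fock" where
  "phi i = phi_series (- i - 1)"

definition phi_star :: "int \<Rightarrow> fock \<Rightarrow> fock" where
  "phi_star i = phi_star_series (- i)"

end

theory Submission
  imports Defs
begin

text \<open>
  Put $u_n = x_n + y_n$.  The operators $\partial x_n - \partial y_n$ kill all $u_n$, so in the coordinates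
  $(u, x)$ the annihilation factors of $\varphi(z)$ and $\varphi^*(z)$ are the translations
  $x_n \mapsto x_n \pm z^{-n}/n$.  Let $P(v) = u_1 v + v^2$ and
  $H(s) = \exp(\sum_m m x_m [v^m] \log(1 + s P(v)))$.  These translations multiply $H$ by
  $(1 + s P(1/z))^{\pm 1}$, and this makes every mode computable on the coefficients of $c(s) H(s)$ when
  $c$ depends on $u$ only.  With $\beta = S_{j-1}(-u) + s\,(u_1 S_j(-u) + S_{j+1}(-u))$ one finds
  $$\varphi_{-j}\, p\,[s^k](c H) = [s^k](\beta c H), \qquad
    \varphi^*_{-1}\,[s^k](\beta^k H) = (k+1)\, p\, [s^{k+1}](\beta^k H),$$
  so that $(\varphi_{-j}\varphi^*_{-1})^k \cdot 1 = k!\,[s^k](\beta^k H)$.  Since $\beta$ is linear in $s$,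
  the binomial series turns $\sum_k a^k [s^k](\beta^k H)$ into $D^{-1} H(a S_{j-1}(-u)/D)$.  Giving
  $x_n$ and $y_n$ weight $n$ makes all rearrangements finite coefficientwise.
\<close>

section \<open>Power series in infinitely many variables\<close>

text \<open>The series H continues the first step of the orbit: \<open>phi_star (- 1)\<close> sends
  the vacuum to p (u_1 x_1 + 2 x_2), in which m [v^m] P(v) is the coefficient of x_m, and this is
  [s^1] H. The exponent of H is linear in x at fixed u, so a translation of x multiplies H by a
  factor free of x; with shifts v^m/m the weights m cancel and the factor is a power of 1 + s P(v)
  itself. The two modes are not equally easy. For phi the factor is a polynomial of degree 2 in 1/z,
  so only three terms survive, and they define beta. For phi_star it is a geometric series, and the
  derivatives in the current are taken at fixed y, not at fixed u, so they also hit beta and the u_1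
  inside H. All these terms collect into W' + k G - s G' with W = beta^k H and G = W
  \<open>YF 2\<close>. The part with G vanishes at s^k because the power of beta equals the
  extracted power of s; this is why the orbit is described by beta^k at s^k.\<close>

lemma mps_coeff_sum [simp]: "mps_coeff (\<Sum>i\<in>A. f i) m = (\<Sum>i\<in>A. mps_coeff (f i) m)"
  by (induction A rule: infinite_finite_induct) (simp_all add: mps_coeff_simps)

lemma mps_coeff_mult: "mps_coeff (f * g) m = (\<Sum>(a, b)\<in>decomps m. mps_coeff f a * mps_coeff g b)"
  by (simp add: mps_coeff_simps)

lemma mps_coeff_const_mult [simp]: "mps_coeff (mps_const c * f) m = c * mps_coeff f m"
proof -
  have "mps_coeff (mps_const c * f) m = (\<Sum>p\<in>decomps m. if p = (0, m) then c * mps_coeff f m else 0)"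
    unfolding mps_coeff_mult mps_const.rep_eq
    by (rule sum.cong) (auto simp: decomps_def split: if_splits)
  also have "\<dots> = c * mps_coeff f m"
    using finite_decomps[of m] by (simp add: decomps_def)
  finally show ?thesis .
qed

lemma mps_const_0 [simp]: "mps_const 0 = 0"
  by (rule mps_eqI) (simp add: mps_const.rep_eq mps_coeff_simps)

lemma mps_const_1 [simp]: "mps_const 1 = 1"
  by (rule mps_eqI) (simp add: mps_const.rep_eq mps_coeff_simps)

lemma mps_const_add: "mps_const (a + b) = mps_const a + mps_const b"
  by (rule mps_eqI) (simp add: mps_const.rep_eq mps_coeff_simps)

lemma mps_const_uminus: "mps_const (- a) = - mps_const a"
  by (rule mps_eqI) (simp add: mps_const.rep_eq mps_coeff_simps)

lemma mps_const_mult: "mps_const (a * b) = mps_const a * mps_const b"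
  by (rule mps_eqI) (simp add: mps_const.rep_eq)

lemma mps_const_power: "mps_const (a ^ n) = mps_const a ^ n"
  by (induction n) (simp_all add: mps_const_mult)

lemma mps_const_of_nat [simp]: "mps_const (of_nat n) = of_nat n"
  by (induction n) (simp_all add: mps_const_add)

text \<open>Multiplying by the constant series 1/n undoes the factor n. This closes every recursion
  below that is obtained from an Euler operator.\<close>

lemma mps_of_nat_cancel:
  fixes f g :: mps
  assumes "of_nat n * f = of_nat n * g" "n > 0"
  shows "f = g"
proof -
  have "f = mps_const (1 / of_nat n) * (mps_const (of_nat n) * f)" for f :: mps
    using assms(2) by (simp add: mult.assoc[symmetric] mps_const_mult[symmetric] del: mps_const_of_nat)
  from this[of f] this[of g] assms(1) show ?thesis
    by simp
qed

lemma mps_const_inverse_of_nat_mult: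
  "n > 0 \<Longrightarrow> of_nat n * mps_const (1 / of_nat n) = 1"
  unfolding mps_const_of_nat[symmetric] mps_const_mult[symmetric] by simp

lemma mps_deriv_add: "mps_deriv v (f + g) = mps_deriv v f + mps_deriv v g"
  by (rule mps_eqI) (simp add: mps_deriv.rep_eq mps_coeff_simps algebra_simps)

lemma mps_deriv_commute: "mps_deriv v (mps_deriv w f) = mps_deriv w (mps_deriv v f)"
proof (rule mps_eqI)
  fix m
  have "m + Poly_Mapping.single v 1 + Poly_Mapping.single w 1
      = m + Poly_Mapping.single w (1::nat) + Poly_Mapping.single v 1"
    by (simp add: ac_simps)
  then show "mps_coeff (mps_deriv v (mps_deriv w f)) m = mps_coeff (mps_deriv w (mps_deriv v f)) m"
    by (auto simp: mps_deriv.rep_eq lookup_add lookup_single when_def simp del: One_nat_def)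
qed

lemma mps_deriv_mult: "mps_deriv v (f * g) = mps_deriv v f * g + f * mps_deriv v g"
proof (rule mps_eqI)
  fix m
  let ?s = "Poly_Mapping.single v (1::nat)" and ?F = "mps_coeff f" and ?G = "mps_coeff g"
  let ?l = "\<lambda>a. Poly_Mapping.lookup a v"
  have split_off: "a = (a - ?s) + ?s" if "?l a \<noteq> 0" for a
    using that by (intro poly_mapping_eqI) (auto simp: lookup_add lookup_minus lookup_single when_def)
  \<comment> \<open>Pairs whose first factor lacks \<open>v\<close> carry the weight 0; on the
    others, removing one \<open>v\<close> from the first factor is a bijection onto
    \<open>decomps m\<close>.\<close>
  have shift: "(\<Sum>p\<in>decomps (m + ?s). of_nat (?l (fst p)) * H (fst p) (snd p))
      = (\<Sum>p\<in>decomps m. of_nat (?l (fst p) + 1) * H (fst p + ?s) (snd p))"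
    for H :: "monom \<Rightarrow> monom \<Rightarrow> complex"
  proof -
    have "(\<Sum>p\<in>decomps (m + ?s). of_nat (?l (fst p)) * H (fst p) (snd p))
        = (\<Sum>p\<in>{p\<in>decomps (m + ?s). ?l (fst p) \<noteq> 0}. of_nat (?l (fst p)) * H (fst p) (snd p))"
      by (rule sum.mono_neutral_right) (auto simp: finite_decomps)
    also have "\<dots> = (\<Sum>p\<in>decomps m. of_nat (?l (fst p) + 1) * H (fst p + ?s) (snd p))"
    proof (rule sum.reindex_bij_witness[where i = "\<lambda>p. (fst p + ?s, snd p)" and j = "\<lambda>p. (fst p - ?s, snd p)"])
      fix p assume p: "p \<in> {p\<in>decomps (m + ?s). ?l (fst p) \<noteq> 0}"
      then have q: "fst p - ?s + ?s = fst p" and pm: "fst p + snd p = m + ?s"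
        using split_off[of "fst p"] by (auto simp: decomps_def)
      show "(fst (fst p - ?s, snd p) + ?s, snd (fst p - ?s, snd p)) = p"
        using q by (simp add: prod_eq_iff)
      have "(fst p - ?s + snd p) + ?s = m + ?s"
        using pm q by (metis add.commute add.left_commute)
      then show "(fst p - ?s, snd p) \<in> decomps m"
        by (simp add: decomps_def)
      show "of_nat (?l (fst (fst p - ?s, snd p)) + 1) * H (fst (fst p - ?s, snd p) + ?s) (snd (fst p - ?s, snd p)) =
          of_nat (?l (fst p)) * H (fst p) (snd p)"
        using p q by (simp add: lookup_minus)
    next
      fix p assume "p \<in> decomps m"
      then have "fst p + snd p = m"
        by (auto simp: decomps_def)
      then have "fst p + ?s + snd p = m + ?s"
        by (metis add.commute add.left_commute)
      then show "(fst p + ?s, snd p) \<in> {p \<in> decomps (m + ?s). ?l (fst p) \<noteq> 0}"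
        by (simp add: decomps_def lookup_add)
    qed (auto simp: prod_eq_iff)
    finally show ?thesis .
  qed
  have swap: "(\<Sum>p\<in>decomps n. H (fst p) (snd p)) = (\<Sum>p\<in>decomps n. H (snd p) (fst p))"
    for n and H :: "monom \<Rightarrow> monom \<Rightarrow> complex"
    by (rule sum.reindex_bij_witness[where i = prod.swap and j = prod.swap])
      (auto simp: decomps_def add.commute)
  have "mps_coeff (mps_deriv v (f * g)) m
      = (\<Sum>p\<in>decomps (m + ?s). of_nat (?l (m + ?s)) * (?F (fst p) * ?G (snd p)))"
    by (simp add: mps_deriv.rep_eq mps_coeff_mult case_prod_unfold sum_distrib_left lookup_add)
  also have "\<dots> = (\<Sum>p\<in>decomps (m + ?s). of_nat (?l (fst p)) * (?F (fst p) * ?G (snd p))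
      + of_nat (?l (snd p)) * (?F (fst p) * ?G (snd p)))"
  proof (rule sum.cong)
    fix p assume "p \<in> decomps (m + ?s)"
    then have "?l (m + ?s) = ?l (fst p) + ?l (snd p)"
      by (auto simp: decomps_def simp flip: lookup_add)
    then show "of_nat (?l (m + ?s)) * (?F (fst p) * ?G (snd p)) = of_nat (?l (fst p)) * (?F (fst p) * ?G (snd p))
        + of_nat (?l (snd p)) * (?F (fst p) * ?G (snd p))"
      by (simp only: of_nat_add distrib_right)
  qed simp
  also have "\<dots> = (\<Sum>p\<in>decomps m. of_nat (?l (fst p) + 1) * (?F (fst p + ?s) * ?G (snd p)))
      + (\<Sum>p\<in>decomps m. of_nat (?l (fst p) + 1) * (?F (snd p) * ?G (fst p + ?s)))"
    unfolding sum.distrib shift[of "\<lambda>a b. ?F a * ?G b"]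
      swap[of "\<lambda>a b. of_nat (?l b) * (?F a * ?G b)"] shift[of "\<lambda>a b. ?F b * ?G a"] ..
  also have "\<dots> = mps_coeff (mps_deriv v f * g + f * mps_deriv v g) m"
    unfolding swap[of "\<lambda>a b. of_nat (?l a + 1) * (?F b * ?G (a + ?s))"]
    by (simp only: plus_mps.rep_eq mps_coeff_mult mps_deriv.rep_eq case_prod_unfold)
      (simp only: ac_simps)
  finally show "mps_coeff (mps_deriv v (f * g)) m = mps_coeff (mps_deriv v f * g + f * mps_deriv v g) m" .
qed

lemma mps_deriv_const [simp]: "mps_deriv v (mps_const c) = 0"
proof (rule mps_eqI)
  fix m
  have "m + Poly_Mapping.single v (1::nat) \<noteq> 0"
    by (metis One_nat_def add_eq_0_iff_both_eq_0 lookup_add lookup_single_eq lookup_zero nat.simps(3))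
  then show "mps_coeff (mps_deriv v (mps_const c)) m = mps_coeff 0 m"
    by (simp add: mps_deriv.rep_eq mps_const.rep_eq mps_coeff_simps)
qed

lemma mps_deriv_var: "mps_deriv v (mps_var w) = (if v = w then 1 else 0)"
proof (rule mps_eqI)
  fix m
  have "m + Poly_Mapping.single v (1::nat) = Poly_Mapping.single w 1 \<longleftrightarrow> m = 0 \<and> v = w"
  proof
    assume eq: "m + Poly_Mapping.single v (1::nat) = Poly_Mapping.single w 1"
    have "v = w"
      using arg_cong[OF eq, of "\<lambda>m. Poly_Mapping.lookup m v"]
      by (auto simp: lookup_add lookup_single when_def split: if_splits)
    with eq show "m = 0 \<and> v = w"
      by simp
  qed simp
  then show "mps_coeff (mps_deriv v (mps_var w)) m = mps_coeff (if v = w then 1 else 0) m"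
    by (auto simp: mps_deriv.rep_eq mps_var.rep_eq mps_coeff_simps)
qed

text \<open>One predicate covers the x-derivatives, the y-derivatives and their differences.
  Vanishing on all constants, and not only on 1, is what yields complex linearity.\<close>

definition derivation :: "(mps \<Rightarrow> mps) \<Rightarrow> bool" where
  "derivation d \<longleftrightarrow> (\<forall>f g. d (f + g) = d f + d g) \<and> (\<forall>f g. d (f * g) = d f * g + f * d g)
     \<and> (\<forall>c. d (mps_const c) = 0)"

context
  fixes d :: "mps \<Rightarrow> mps"
  assumes d: "derivation d"
begin

lemma derivation_add: "d (f + g) = d f + d g"
  and derivation_mult: "d (f * g) = d f * g + f * d g"
  and derivation_const: "d (mps_const c) = 0"
  using d by (auto simp: derivation_def)

lemma derivation_0: "d 0 = 0" and derivation_1: "d 1 = 0"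
  using derivation_const[of 0] derivation_const[of 1] by simp_all

lemma derivation_uminus: "d (- f) = - d f"
  using derivation_add[of f "- f"] derivation_0 by (simp add: eq_neg_iff_add_eq_0 add.commute)

lemma derivation_diff: "d (f - g) = d f - d g"
  using derivation_add[of f "- g"] derivation_uminus[of g] by simp

lemma derivation_sum: "d (\<Sum>i\<in>A. f i) = (\<Sum>i\<in>A. d (f i))"
  by (induction A rule: infinite_finite_induct) (simp_all add: derivation_add derivation_0)

lemma derivation_const_mult: "d (mps_const c * f) = mps_const c * d f"
  by (simp add: derivation_mult derivation_const)

lemma derivation_of_nat: "d (of_nat n) = 0"
  using derivation_const[of "of_nat n"] by simp

lemma derivation_of_nat_mult: "d (of_nat n * f) = of_nat n * d f"
  by (simp add: derivation_mult derivation_of_nat)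

end

lemma derivation_mps_deriv: "derivation (mps_deriv v)"
  by (simp add: derivation_def mps_deriv_add mps_deriv_mult)

lemma derivation_dx: "derivation (dx n)" and derivation_dy: "derivation (dy n)"
  by (simp_all add: dx_def dy_def derivation_mps_deriv)

text \<open>This is the partial derivative in x_n at fixed u, whereas \<open>dx\<close> and
  \<open>dy\<close> also move u_n.\<close>

definition dd :: "nat \<Rightarrow> mps \<Rightarrow> mps" where
  "dd n f = dx n f - dy n f"

lemma derivation_dd: "derivation (dd n)"
  using derivation_dx[of n] derivation_dy[of n]
  by (simp add: dd_def[abs_def] derivation_def algebra_simps)

lemma dd_commute: "dd m (dd n f) = dd n (dd m f)"
  unfolding dd_def dx_def dy_def derivation_diff[OF derivation_mps_deriv]
    mps_deriv_commute[of "Xvar (m - 1)"] mps_deriv_commute[of "Yvar (m - 1)"]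
  by simp

lemma dx_xv: "m \<ge> 1 \<Longrightarrow> n \<ge> 1 \<Longrightarrow> dx m (xv n) = (if m = n then 1 else 0)"
  and dx_yv: "dx m (yv n) = 0"
  and dy_xv: "dy m (xv n) = 0"
  and dy_yv: "m \<ge> 1 \<Longrightarrow> n \<ge> 1 \<Longrightarrow> dy m (yv n) = (if m = n then 1 else 0)"
  by (auto simp: dx_def dy_def xv_def yv_def mps_deriv_var)

definition uv :: "nat \<Rightarrow> mps" where
  "uv n = xv n + yv n"

lemma dx_uv: "m \<ge> 1 \<Longrightarrow> n \<ge> 1 \<Longrightarrow> dx m (uv n) = (if m = n then 1 else 0)"
  by (simp add: uv_def derivation_add[OF derivation_dx] dx_xv dx_yv)

lemma dd_uv: "m \<ge> 1 \<Longrightarrow> n \<ge> 1 \<Longrightarrow> dd m (uv n) = 0"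
  and dd_xv: "m \<ge> 1 \<Longrightarrow> n \<ge> 1 \<Longrightarrow> dd m (xv n) = (if m = n then 1 else 0)"
  by (simp_all add: dd_def uv_def derivation_add[OF derivation_dx] derivation_add[OF derivation_dy]
      dx_xv dx_yv dy_xv dy_yv)

section \<open>Elementary Schur polynomials\<close>

abbreviation tser :: "(nat \<Rightarrow> mps) \<Rightarrow> mps fps" where
  "tser t \<equiv> Abs_fps (\<lambda>n. if n = 0 then 0 else t n)"

lemma tser_power_nth_0:
  fixes T :: "mps fps"
  assumes "fps_nth T 0 = 0" "k < m"
  shows "fps_nth (T ^ m) k = 0"
  using assms(2)
proof (induction m arbitrary: k)
  case (Suc m)
  have "fps_nth T i * fps_nth (T ^ m) (k - i) = 0" if "i \<le> k" for i
    using assms(1) Suc that by (cases "i = 0") auto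
  then show ?case
    by (simp add: fps_mult_nth)
qed simp

definition expS :: "(nat \<Rightarrow> mps) \<Rightarrow> mps fps" where
  "expS t = Abs_fps (\<lambda>k. schur k t)"

text \<open>The defining sum stops at an index depending on the coefficient; a common bound makes
  finitely many coefficients come from one partial sum of the exponential series.\<close>

lemma schur_bound:
  assumes "k \<le> M"
  shows "schur k t = (\<Sum>m\<le>M. mps_const (1 / fact m) * fps_nth (tser t ^ m) k)"
  unfolding schur_def using assms
  by (intro sum.mono_neutral_left) (auto simp: tser_power_nth_0)

lemma schur_0 [simp]: "schur 0 t = 1"
  by (simp add: schur_def)

lemma schur_1: "schur 1 t = t 1" "schur (Suc 0) t = t 1"
  by (simp_all add: schur_def)

text \<open>
  The hypothesis \<open>trunc\<close> lets us replace the exponential series by its partial sums, to which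
  the Leibniz rule applies.
\<close>

lemma expS_derivation:
  fixes D :: "mps fps \<Rightarrow> mps fps" and t :: "nat \<Rightarrow> mps"
  assumes add: "\<And>f g. D (f + g) = D f + D g"
    and mult: "\<And>f g. D (f * g) = D f * g + f * D g"
    and const: "\<And>c. D (fps_const (mps_const c)) = 0"
    and trunc: "\<And>f g k. (\<forall>i\<le>Suc k. fps_nth f i = fps_nth g i) \<Longrightarrow> fps_nth (D f) k = fps_nth (D g) k"
  shows "D (expS t) = D (tser t) * expS t"
proof (rule fps_ext)
  fix k
  define T where "T = tser t"
  define G where "G M = (\<Sum>m\<le>M. fps_const (mps_const (1 / fact m)) * T ^ m)" for M
  have D0: "D 0 = 0"
    using add[of 0 0] by simp
  have Dsum: "D (\<Sum>i\<in>A. f i) = (\<Sum>i\<in>A. D (f i))" for A :: "nat set" and f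
    by (induction A rule: infinite_finite_induct) (simp_all add: D0 add)
  have D1: "D 1 = 0"
    using const[of 1] by simp
  have Dpow: "D (T ^ m) = of_nat m * T ^ (m - 1) * D T" for m
  proof (induction m)
    case (Suc m)
    then show ?case
      by (cases m) (simp_all add: mult D1 algebra_simps)
  qed (simp add: D1)
  have G_nth: "fps_nth (G M) i = schur i t" if "i \<le> M" for i M
    using schur_bound[OF that, of t] by (simp add: G_def T_def fps_sum_nth)
  have DG: "D (G (Suc M)) = D T * G M" for M
  proof -
    have "D (G (Suc M)) = (\<Sum>m\<le>Suc M. fps_const (mps_const (1 / fact m)) * (of_nat m * T ^ (m - 1) * D T))"
      by (simp add: G_def Dsum mult const Dpow del: sum.atMost_Suc)
    also have "\<dots> = (\<Sum>m\<le>M. fps_const (mps_const (1 / fact (Suc m))) * (of_nat (Suc m) * T ^ m * D T))"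
      by (subst sum.atMost_Suc_shift) simp
    also have "\<dots> = (\<Sum>m\<le>M. fps_const (mps_const (1 / fact m)) * (T ^ m * D T))"
    proof (rule sum.cong)
      fix m
      have "mps_const (1 / fact (Suc m)) * of_nat (Suc m) = mps_const (1 / fact m)"
        unfolding mps_const_of_nat[symmetric] mps_const_mult[symmetric]
        by (simp add: divide_simps del: of_nat_Suc)
      then have "fps_const (mps_const (1 / fact (Suc m))) * of_nat (Suc m) = fps_const (mps_const (1 / fact m))"
        unfolding fps_of_nat[symmetric] by simp
      then show "fps_const (mps_const (1 / fact (Suc m))) * (of_nat (Suc m) * T ^ m * D T)
          = fps_const (mps_const (1 / fact m)) * (T ^ m * D T)"
        by (simp only: mult.assoc[symmetric])
    qed simp
    also have "\<dots> = D T * G M"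
      by (simp add: G_def sum_distrib_left ac_simps)
    finally show ?thesis .
  qed
  have "fps_nth (D (expS t)) k = fps_nth (D (G (Suc k))) k"
    by (rule trunc) (simp add: expS_def G_nth)
  also have "\<dots> = (\<Sum>i\<le>k. fps_nth (D T) i * schur (k - i) t)"
    unfolding DG by (simp add: fps_mult_nth G_nth atMost_atLeast0)
  also have "\<dots> = fps_nth (D (tser t) * expS t) k"
    by (simp add: T_def expS_def fps_mult_nth atMost_atLeast0)
  finally show "fps_nth (D (expS t)) k = fps_nth (D (tser t) * expS t) k" .
qed

lemma expS_deriv: "fps_deriv (expS t) = fps_deriv (tser t) * expS t"
  by (rule expS_derivation) (auto simp: algebra_simps)

definition fps_map :: "(mps \<Rightarrow> mps) \<Rightarrow> mps fps \<Rightarrow> mps fps" where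
  "fps_map d f = Abs_fps (\<lambda>n. d (fps_nth f n))"

lemma fps_map_nth [simp]: "fps_nth (fps_map d f) n = d (fps_nth f n)"
  by (simp add: fps_map_def)

context
  fixes d :: "mps \<Rightarrow> mps"
  assumes d: "derivation d"
begin

lemma fps_map_add: "fps_map d (f + g) = fps_map d f + fps_map d g"
  by (rule fps_ext) (simp add: derivation_add[OF d])

lemma fps_map_mult: "fps_map d (f * g) = fps_map d f * g + f * fps_map d g"
  by (rule fps_ext)
    (simp add: fps_mult_nth derivation_sum[OF d] derivation_mult[OF d] sum.distrib)

lemma fps_map_fps_const: "fps_map d (fps_const c) = fps_const (d c)"
  by (rule fps_ext) (simp add: derivation_0[OF d])

lemma fps_map_1: "fps_map d 1 = 0"
  using fps_map_fps_const[of 1] by (simp add: derivation_1[OF d])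

lemma fps_map_power: "fps_map d (f ^ n) = of_nat n * f ^ (n - 1) * fps_map d f"
proof (induction n)
  case (Suc n)
  then show ?case
    by (cases n) (simp_all add: fps_map_mult fps_map_1 algebra_simps)
qed (simp add: fps_map_1)

lemma fps_map_expS: "fps_map d (expS t) = fps_map d (tser t) * expS t"
  by (rule expS_derivation)
    (auto simp: fps_map_add fps_map_mult fps_map_fps_const derivation_const[OF d])

end

section \<open>Convergence and weights\<close>

text \<open>A basic neighbourhood in the product topology restricts only finitely many coefficients,
  so it suffices that each single coefficient becomes constant.\<close>

lemma mps_tendsto_eventually_const:
  fixes f :: "'a \<Rightarrow> mps"
  assumes "\<And>m. eventually (\<lambda>x. mps_coeff (f x) m = mps_coeff l m) F"
  shows "(f \<longlongrightarrow> l) F"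
proof (rule topological_tendstoI)
  fix U :: "mps set" assume U: "open U" "l \<in> U"
  have "openin (product_topology (\<lambda>_. euclidean) UNIV) (mps_coeff ` U)"
    using U(1) by (simp add: open_mps_def open_fun_def)
  then obtain X where X: "mps_coeff l \<in> Pi\<^sub>E UNIV X" "finite {i. X i \<noteq> UNIV}" "Pi\<^sub>E UNIV X \<subseteq> mps_coeff ` U"
    using product_topology_open_contains_basis[of "\<lambda>_. euclidean" UNIV "mps_coeff ` U" "mps_coeff l"] U(2)
    by auto
  have "eventually (\<lambda>x. \<forall>m\<in>{i. X i \<noteq> UNIV}. mps_coeff (f x) m = mps_coeff l m) F"
    by (intro eventually_ball_finite X(2) ballI assms)
  then show "eventually (\<lambda>x. f x \<in> U) F"
  proof (rule eventually_mono)
    fix x assume x: "\<forall>m\<in>{i. X i \<noteq> UNIV}. mps_coeff (f x) m = mps_coeff l m"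
    have "mps_coeff (f x) m \<in> X m" for m
      using x X(1) by (cases "X m = UNIV") (auto simp: PiE_iff)
    then have "mps_coeff (f x) \<in> Pi\<^sub>E UNIV X"
      by (auto simp: PiE_iff)
    then have "mps_coeff (f x) \<in> mps_coeff ` U"
      using X(3) by blast
    then show "f x \<in> U"
      by (auto simp: mps_coeff_inject)
  qed
qed

section \<open>Weights of monomials and orders of series\<close>

definition var_weight :: "var \<Rightarrow> nat" where
  "var_weight v = (case v of Xvar n \<Rightarrow> n + 1 | Yvar n \<Rightarrow> n + 1)"

definition weight :: "monom \<Rightarrow> nat" where
  "weight m = (\<Sum>v\<in>Poly_Mapping.keys m. Poly_Mapping.lookup m v * var_weight v)"

lemma weight_superset:
  assumes "Poly_Mapping.keys m \<subseteq> A" "finite A"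
  shows "weight m = (\<Sum>v\<in>A. Poly_Mapping.lookup m v * var_weight v)"
  unfolding weight_def using assms by (intro sum.mono_neutral_left) (auto simp: in_keys_iff)

lemma weight_add: "weight (a + b) = weight a + weight b"
proof -
  let ?A = "Poly_Mapping.keys a \<union> Poly_Mapping.keys b"
  have "Poly_Mapping.keys (a + b) \<subseteq> ?A"
    by (rule Poly_Mapping.keys_add)
  then show ?thesis
    by (simp add: weight_superset[of _ ?A] lookup_add sum.distrib distrib_right)
qed

lemma weight_decomps: "(a, b) \<in> decomps m \<Longrightarrow> weight a + weight b = weight m"
  by (auto simp: decomps_def weight_add)

lemma weight_single: "weight (Poly_Mapping.single v 1) = var_weight v"
  by (simp add: weight_def)

definition ord_ge :: "nat \<Rightarrow> mps \<Rightarrow> bool" where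
  "ord_ge n f \<longleftrightarrow> (\<forall>m. weight m < n \<longrightarrow> mps_coeff f m = 0)"

lemma ord_ge_0 [simp]: "ord_ge 0 f"
  by (simp add: ord_ge_def)

lemma ord_ge_zero [simp]: "ord_ge n 0"
  by (simp add: ord_ge_def mps_coeff_simps)

lemma ord_ge_mono: "ord_ge n f \<Longrightarrow> m \<le> n \<Longrightarrow> ord_ge m f"
  by (auto simp: ord_ge_def)

lemma ord_ge_add: "ord_ge n f \<Longrightarrow> ord_ge n g \<Longrightarrow> ord_ge n (f + g)"
  by (auto simp: ord_ge_def mps_coeff_simps)

lemma ord_ge_uminus: "ord_ge n f \<Longrightarrow> ord_ge n (- f)"
  by (auto simp: ord_ge_def mps_coeff_simps)

lemma ord_ge_sum: "(\<And>i. i \<in> A \<Longrightarrow> ord_ge n (f i)) \<Longrightarrow> ord_ge n (\<Sum>i\<in>A. f i)"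
  by (simp add: ord_ge_def)

lemma ord_ge_mult:
  assumes "ord_ge m f" "ord_ge n g"
  shows "ord_ge (m + n) (f * g)"
  unfolding ord_ge_def
proof (intro allI impI)
  fix k assume k: "weight k < m + n"
  have "mps_coeff f a * mps_coeff g b = 0" if "(a, b) \<in> decomps k" for a b
  proof (cases "weight a < m")
    case False
    then have "weight b < n"
      using k weight_decomps[OF that] by simp
    then show ?thesis
      using assms(2) by (simp add: ord_ge_def)
  qed (use assms(1) in \<open>simp add: ord_ge_def\<close>)
  then show "mps_coeff (f * g) k = 0"
    unfolding mps_coeff_mult by (intro sum.neutral) auto
qed

lemma ord_ge_mult_left: "ord_ge n g \<Longrightarrow> ord_ge n (f * g)"
  using ord_ge_mult[of 0 f n g] by simp

lemma ord_ge_mult_right: "ord_ge n f \<Longrightarrow> ord_ge n (f * g)"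
  using ord_ge_mult[of n f 0 g] by simp

lemma ord_ge_power: "ord_ge m f \<Longrightarrow> ord_ge (n * m) (f ^ n)"
  by (induction n) (auto intro: ord_ge_mult)

lemma ord_ge_xv: "n \<ge> 1 \<Longrightarrow> ord_ge n (xv n)" and ord_ge_yv: "n \<ge> 1 \<Longrightarrow> ord_ge n (yv n)"
  unfolding ord_ge_def xv_def yv_def mps_var.rep_eq
  by (auto simp: weight_single[unfolded One_nat_def] var_weight_def)

text \<open>These series may be evaluated at 1: every coefficient of the value is a finite sum.\<close>

definition filtered :: "mps fps \<Rightarrow> bool" where
  "filtered F \<longleftrightarrow> (\<forall>k. ord_ge k (fps_nth F k))"

text \<open>For a filtered series the terms of index above \<open>weight m\<close> do not reach the
  monomial \<open>m\<close>. For other series the value is a mere truncation.\<close>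

lift_definition eval1 :: "mps fps \<Rightarrow> mps"
  is "\<lambda>F m. \<Sum>k\<le>weight m. mps_coeff (fps_nth F k) m" .

lemma eval1_bound:
  assumes "filtered F" "weight m \<le> N"
  shows "mps_coeff (eval1 F) m = (\<Sum>k\<le>N. mps_coeff (fps_nth F k) m)"
  unfolding eval1.rep_eq using assms
  by (intro sum.mono_neutral_left) (auto simp: filtered_def ord_ge_def)

lemma eval1_sums:
  assumes "filtered F"
  shows "fps_nth F sums eval1 F"
  unfolding sums_def_le
proof (rule mps_tendsto_eventually_const)
  show "\<forall>\<^sub>F n in sequentially. mps_coeff (\<Sum>k\<le>n. fps_nth F k) m = mps_coeff (eval1 F) m" for m
    unfolding eventually_sequentially
    by (rule exI[of _ "weight m"]) (simp add: eval1_bound[OF assms])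
qed

text \<open>The exponent in the theorem is an unordered sum over n >= 1, so convergence is needed
  along finite sets as well as along partial sums.\<close>

lemma eval1_has_sum:
  assumes "filtered F" "fps_nth F 0 = 0"
  shows "(fps_nth F has_sum eval1 F) {1..}"
  unfolding has_sum_def
proof (rule mps_tendsto_eventually_const)
  fix m
  have "mps_coeff (sum (fps_nth F) X) m = mps_coeff (eval1 F) m"
    if X: "finite X" "{1..weight m} \<subseteq> X" "X \<subseteq> {1..}" for X
  proof -
    have "mps_coeff (sum (fps_nth F) X) m = (\<Sum>k\<in>{1..weight m}. mps_coeff (fps_nth F k) m)"
      unfolding mps_coeff_sum using X assms(1)
      by (intro sum.mono_neutral_right) (auto simp: filtered_def ord_ge_def)
    also have "\<dots> = (\<Sum>k\<le>weight m. mps_coeff (fps_nth F k) m)"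
      using assms(2) by (intro sum.mono_neutral_left) (auto simp: mps_coeff_simps not_less_eq_eq)
    finally show ?thesis
      by (simp add: eval1.rep_eq)
  qed
  then show "\<forall>\<^sub>F X in finite_subsets_at_top {1..}. mps_coeff (sum (fps_nth F) X) m = mps_coeff (eval1 F) m"
    unfolding eventually_finite_subsets_at_top by (intro exI[of _ "{1..weight m}"]) auto
qed

lemma filtered_const [simp]: "filtered (fps_const c)"
  by (simp add: filtered_def)

lemma filtered_1 [simp]: "filtered 1"
  using filtered_const[of 1] by simp

lemma filtered_mult: "filtered F \<Longrightarrow> filtered G \<Longrightarrow> filtered (F * G)"
  unfolding filtered_def fps_mult_nth
proof (intro allI ord_ge_sum)
  fix k i :: nat
  assume FG: "\<forall>k. ord_ge k (fps_nth F k)" "\<forall>k. ord_ge k (fps_nth G k)" and i: "i \<in> {0..k}"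
  from FG have "ord_ge (i + (k - i)) (fps_nth F i * fps_nth G (k - i))"
    by (intro ord_ge_mult) auto
  with i show "ord_ge k (fps_nth F i * fps_nth G (k - i))"
    by simp
qed

lemma filtered_power: "filtered F \<Longrightarrow> filtered (F ^ n)"
  by (induction n) (auto intro: filtered_mult)

lemma eval1_const [simp]: "eval1 (fps_const c) = c"
proof (rule mps_eqI)
  fix m
  have "mps_coeff (eval1 (fps_const c)) m = (\<Sum>k\<le>weight m. if k = 0 then mps_coeff c m else 0)"
    unfolding eval1.rep_eq by (rule sum.cong) (auto simp: mps_coeff_simps)
  then show "mps_coeff (eval1 (fps_const c)) m = mps_coeff c m"
    by simp
qed

lemma eval1_1 [simp]: "eval1 1 = 1"
  using eval1_const[of 1] by simp

lemma eval1_diff: "eval1 (F - G) = eval1 F - eval1 G"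
  by (rule mps_eqI) (simp add: eval1.rep_eq mps_coeff_simps sum_subtractf)

text \<open>For a factorization of \<open>m\<close> into a and b, a nonzero contribution of indices
  i and l forces i <= weight a and l <= weight b, hence i + l <= weight m. So the triangle of the
  Cauchy product and the full square give the same sum.\<close>

lemma eval1_mult:
  assumes "filtered F" "filtered G"
  shows "eval1 (F * G) = eval1 F * eval1 G"
proof (rule mps_eqI)
  fix m
  let ?f = "\<lambda>i a. mps_coeff (fps_nth F i) a" and ?g = "\<lambda>i a. mps_coeff (fps_nth G i) a"
  let ?w = "weight m"
  have pair: "(\<Sum>k\<le>?w. \<Sum>i\<le>k. ?f i a * ?g (k - i) b) = (\<Sum>i\<le>?w. ?f i a) * (\<Sum>i\<le>?w. ?g i b)"
    if "(a, b) \<in> decomps m" for a b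
  proof -
    have "(\<Sum>k\<le>?w. \<Sum>i\<le>k. ?f i a * ?g (k - i) b) = (\<Sum>(i, l)\<in>{(i::nat, l). i + l \<le> ?w}. ?f i a * ?g l b)"
      by (rule sum.triangle_reindex_eq[symmetric])
    also have "\<dots> = (\<Sum>(i, l)\<in>{..?w} \<times> {..?w}. ?f i a * ?g l b)"
    proof (intro sum.mono_neutral_left ballI)
      fix p assume "p \<in> {..?w} \<times> {..?w} - {(i::nat, l). i + l \<le> ?w}"
      then obtain i l where p: "p = (i, l)" "i + l > ?w"
        by auto
      then have "weight a < i \<or> weight b < l"
        using weight_decomps[OF that] by linarith
      then show "(case p of (i, l) \<Rightarrow> ?f i a * ?g l b) = 0"
        using assms by (auto simp: p filtered_def ord_ge_def)
    qed auto
    also have "\<dots> = (\<Sum>i\<le>?w. ?f i a) * (\<Sum>i\<le>?w. ?g i b)"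
      by (simp add: sum_product sum.cartesian_product)
    finally show ?thesis .
  qed
  have "mps_coeff (eval1 (F * G)) m
      = (\<Sum>k\<le>?w. \<Sum>i\<le>k. \<Sum>(a, b)\<in>decomps m. ?f i a * ?g (k - i) b)"
    by (simp add: eval1.rep_eq fps_mult_nth mps_coeff_mult atMost_atLeast0)
  also have "\<dots> = (\<Sum>p\<in>decomps m. \<Sum>k\<le>?w. \<Sum>i\<le>k. ?f i (fst p) * ?g (k - i) (snd p))"
    unfolding case_prod_unfold sum.swap[of _ _ "decomps m"] ..
  also have "\<dots> = (\<Sum>p\<in>decomps m. (\<Sum>i\<le>?w. ?f i (fst p)) * (\<Sum>i\<le>?w. ?g i (snd p)))"
    by (rule sum.cong) (auto simp: pair)
  also have "\<dots> = (\<Sum>p\<in>decomps m. mps_coeff (eval1 F) (fst p) * mps_coeff (eval1 G) (snd p))"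
  proof (rule sum.cong)
    fix p assume "p \<in> decomps m"
    then have "weight (fst p) + weight (snd p) = ?w"
      using weight_decomps[of "fst p" "snd p"] by simp
    then show "(\<Sum>i\<le>?w. ?f i (fst p)) * (\<Sum>i\<le>?w. ?g i (snd p))
        = mps_coeff (eval1 F) (fst p) * mps_coeff (eval1 G) (snd p)"
      using assms by (simp add: eval1_bound[of _ _ ?w])
  qed simp
  also have "\<dots> = mps_coeff (eval1 F * eval1 G) m"
    by (simp add: mps_coeff_mult case_prod_unfold)
  finally show "mps_coeff (eval1 (F * G)) m = mps_coeff (eval1 F * eval1 G) m" .
qed

lemma eval1_power: "filtered F \<Longrightarrow> eval1 (F ^ n) = eval1 F ^ n"
  by (induction n) (simp_all add: eval1_mult filtered_power)

text \<open>Fubini for a family in which \<open>G k\<close> is divisible by s^k: collecting by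
  powers of s before setting s = 1 agrees with summing the values over k. A monomial sees only
  indices up to its weight, so the exchange is finite.\<close>

lemma
  fixes G :: "nat \<Rightarrow> mps fps"
  assumes filt: "\<And>k. filtered (G k)"
    and low: "\<And>k i. i < k \<Longrightarrow> fps_nth (G k) i = 0"
  shows filtered_diagonal: "filtered (Abs_fps (\<lambda>m. \<Sum>k\<le>m. fps_nth (G k) m))"
    and filtered_eval1: "filtered (Abs_fps (\<lambda>k. eval1 (G k)))"
    and eval1_diagonal: "eval1 (Abs_fps (\<lambda>m. \<Sum>k\<le>m. fps_nth (G k) m)) = eval1 (Abs_fps (\<lambda>k. eval1 (G k)))"
proof -
  show 1: "filtered (Abs_fps (\<lambda>m. \<Sum>k\<le>m. fps_nth (G k) m))"
    using filt by (auto simp: filtered_def intro!: ord_ge_sum)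
  show 2: "filtered (Abs_fps (\<lambda>k. eval1 (G k)))"
    by (auto simp: filtered_def ord_ge_def eval1.rep_eq low mps_coeff_simps intro!: sum.neutral)
  show "eval1 (Abs_fps (\<lambda>m. \<Sum>k\<le>m. fps_nth (G k) m)) = eval1 (Abs_fps (\<lambda>k. eval1 (G k)))"
  proof (rule mps_eqI)
    fix m
    let ?w = "weight m"
    have "mps_coeff (eval1 (Abs_fps (\<lambda>m. \<Sum>k\<le>m. fps_nth (G k) m))) m
        = (\<Sum>i\<le>?w. \<Sum>k\<le>i. mps_coeff (fps_nth (G k) i) m)"
      by (simp add: eval1.rep_eq)
    also have "\<dots> = (\<Sum>i\<le>?w. \<Sum>k\<le>?w. mps_coeff (fps_nth (G k) i) m)"
      by (intro sum.cong sum.mono_neutral_left) (auto simp: low mps_coeff_simps)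
    also have "\<dots> = mps_coeff (eval1 (Abs_fps (\<lambda>k. eval1 (G k)))) m"
      by (subst sum.swap) (simp add: eval1.rep_eq)
    finally show "mps_coeff (eval1 (Abs_fps (\<lambda>m. \<Sum>k\<le>m. fps_nth (G k) m))) m =
      mps_coeff (eval1 (Abs_fps (\<lambda>k. eval1 (G k)))) m" .
  qed
qed

text \<open>The m-th exponential term of \<open>T\<close> is divisible by s^m because
  \<open>T\<close> has no constant term, so the diagonal regrouping identifies the exponential of a
  value with the value of an exponential.\<close>

lemma
  fixes T :: "mps fps"
  assumes T: "filtered T" "fps_nth T 0 = 0"
  shows filtered_expS: "filtered (expS (fps_nth T))"
    and mps_exp_eval1: "mps_exp (eval1 T) = eval1 (expS (fps_nth T))"
proof -
  define G where "G m = fps_const (mps_const (1 / fact m)) * T ^ m" for m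
  have T': "tser (fps_nth T) = T"
    by (rule fps_ext) (simp add: T(2))
  have expS: "expS (fps_nth T) = Abs_fps (\<lambda>k. \<Sum>m\<le>k. fps_nth (G m) k)"
    by (rule fps_ext) (simp add: expS_def schur_def T' G_def)
  have G: "filtered (G m)" "eval1 (G m) = mps_const (1 / fact m) * eval1 T ^ m" for m
    using T(1) by (simp_all add: G_def filtered_mult filtered_power eval1_mult eval1_power)
  have low: "fps_nth (G m) i = 0" if "i < m" for m i
    using tser_power_nth_0[OF T(2) that] by (simp add: G_def)
  show "filtered (expS (fps_nth T))"
    unfolding expS by (rule filtered_diagonal[OF G(1) low])
  have "mps_exp (eval1 T) = suminf (fps_nth (Abs_fps (\<lambda>m. eval1 (G m))))"
    by (simp add: mps_exp_def G(2) Abs_fps_inverse)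
  also have "\<dots> = eval1 (Abs_fps (\<lambda>m. eval1 (G m)))"
    by (rule sums_unique[symmetric], rule eval1_sums, rule filtered_eval1[OF G(1) low])
  also have "\<dots> = eval1 (expS (fps_nth T))"
    unfolding expS by (rule eval1_diagonal[OF G(1) low, symmetric])
  finally show "mps_exp (eval1 T) = eval1 (expS (fps_nth T))" .
qed

section \<open>The generating series of the solution\<close>

definition u1 :: mps where
  "u1 = uv 1"

text \<open>
  \<open>fps_X\<close> stands for $v = 1/z$ in \<open>Q\<close> and \<open>V\<close>, and for an independent variable $s$ in \<open>H\<close>, \<open>pis\<close>,
  \<open>beta\<close> and \<open>YF\<close> below.  \<open>Lam n\<close> is the coefficient of $s^n$ in $\sum_m m x_m [v^m] \log(1 - s Q(v))$,
  and \<open>pis i\<close> is the coefficient of $v^i$ in $1 / (1 - s Q(v))$.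
\<close>

definition Q :: "mps fps" where
  "Q = - (fps_const u1 * fps_X + fps_X ^ 2)"

definition V :: "mps fps" where
  "V = fps_const u1 * fps_X + 2 * fps_X ^ 2"

definition pim :: "nat \<Rightarrow> nat \<Rightarrow> mps" where
  "pim r i = fps_nth (Q ^ r) i"

lemma V_Q: "fps_X * fps_deriv Q = - V"
  by (simp add: Q_def V_def fps_deriv_power power2_eq_square algebra_simps)

lemma V_nth_0 [simp]: "fps_nth V 0 = 0" and Q_nth_0 [simp]: "fps_nth Q 0 = 0"
  by (simp_all add: V_def Q_def fps_mult_nth_0 power2_eq_square)

lemma Q_mult_nth:
  "fps_nth (Q * f) i = - (u1 * (if i = 0 then 0 else fps_nth f (i - 1)) + (if i < 2 then 0 else fps_nth f (i - 2)))"
proof -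
  have "Q * f = - (fps_const u1 * (fps_X * f)) - fps_X * (fps_X * f)"
    by (simp add: Q_def power2_eq_square algebra_simps)
  then show ?thesis
    by (auto simp: numeral_2_eq_2)
qed

lemma pim_0: "pim 0 i = (if i = 0 then 1 else 0)"
  by (simp add: pim_def)

lemma pim_Suc:
  "pim (Suc r) i = - (u1 * (if i = 0 then 0 else pim r (i - 1)) + (if i < 2 then 0 else pim r (i - 2)))"
  unfolding pim_def power_Suc Q_mult_nth ..

lemma pim_eq_0: "i > 2 * r \<Longrightarrow> pim r i = 0"
  by (induction r arbitrary: i) (auto simp: pim_0 pim_Suc)

lemma pim_eq_0_low: "i < r \<Longrightarrow> pim r i = 0"
  by (induction r arbitrary: i) (auto simp: pim_Suc)

text \<open>The Euler operator v d/dv applied to Q^n. It converts the weight m of x_m into the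
  factor V = - v Q'(v).\<close>

lemma V_Q_power_nth: "of_nat i * pim n i = - of_nat n * fps_nth (V * Q ^ (n - 1)) i"
proof -
  have "of_nat i * pim n i = fps_nth (fps_X * fps_deriv (Q ^ n)) i"
    by (cases i) (simp_all add: pim_def)
  also have "fps_X * fps_deriv (Q ^ n) = of_nat n * (fps_X * fps_deriv Q) * Q ^ (n - 1)"
    by (simp add: fps_deriv_power fps_of_nat ac_simps)
  also have "\<dots> = - of_nat n * (V * Q ^ (n - 1))"
    by (simp add: V_Q mult.assoc)
  also have "fps_nth (- of_nat n * (V * Q ^ (n - 1))) i = - of_nat n * fps_nth (V * Q ^ (n - 1)) i"
    by (simp flip: fps_of_nat)
  finally show ?thesis .
qed

lemma dx_u1: "l \<ge> 1 \<Longrightarrow> dx l u1 = (if l = 1 then 1 else 0)" and dd_u1: "l \<ge> 1 \<Longrightarrow> dd l u1 = 0"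
  by (simp_all add: u1_def dx_uv dd_uv)

lemma fps_map_uminus: "derivation d \<Longrightarrow> fps_map d (- f) = - fps_map d f"
  by (rule fps_ext) (simp add: derivation_uminus)

lemma fps_map_X: "derivation d \<Longrightarrow> fps_map d fps_X = 0"
  by (rule fps_ext) (simp add: fps_X_def derivation_0 derivation_1)

text \<open>Chain rule: Q involves the variables only through u_1, and its derivative in u_1 is
  -v.\<close>

lemma derivation_pim:
  assumes "derivation d"
  shows "d (pim r i) = - (of_nat r * d u1 * (if i = 0 then 0 else pim (r - 1) (i - 1)))"
proof -
  have "fps_map d Q = - (fps_const (d u1) * fps_X)"
    unfolding Q_def power2_eq_square
    by (simp only: fps_map_uminus[OF assms] fps_map_add[OF assms] fps_map_mult[OF assms]
        fps_map_fps_const[OF assms] fps_map_X[OF assms]) simp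
  then have "fps_map d (Q ^ r) = - (of_nat r * (fps_const (d u1) * (fps_X * Q ^ (r - 1))))"
    by (simp add: fps_map_power[OF assms] ac_simps)
  then have "d (pim r i) = fps_nth (- (of_nat r * (fps_const (d u1) * (fps_X * Q ^ (r - 1))))) i"
    unfolding pim_def fps_map_nth[symmetric] by (rule arg_cong)
  also have "\<dots> = - (of_nat r * (d u1 * fps_nth (fps_X * Q ^ (r - 1)) i))"
    by (simp only: fps_neg_nth fps_of_nat[symmetric] fps_mult_left_const_nth)
  finally show ?thesis
    by (simp add: pim_def mult.assoc)
qed

lemma dd_pim: "l \<ge> 1 \<Longrightarrow> dd l (pim r i) = 0"
  by (simp add: derivation_pim[OF derivation_dd] dd_u1)

section \<open>The exponent of H and its derivatives at fixed u\<close>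

definition Lam :: "nat \<Rightarrow> mps" where
  "Lam n = - (mps_const (1 / of_nat n) * (\<Sum>m=1..2*n. pim n m * (of_nat m * xv m)))"

definition H :: "mps fps" where
  "H = expS Lam"

lemma Lam_0 [simp]: "Lam 0 = 0"
  by (simp add: Lam_def)

lemma tser_Lam [simp]: "tser Lam = Abs_fps Lam"
  by (rule fps_ext) simp

lemma H_nth_0 [simp]: "fps_nth H 0 = 1"
  by (simp add: H_def expS_def)

lemma of_nat_Lam:
  assumes "2 * n \<le> M"
  shows "of_nat n * Lam n = - (\<Sum>m=1..M. pim n m * (of_nat m * xv m))"
proof (cases "n = 0")
  case False
  have "(\<Sum>m=1..2*n. pim n m * (of_nat m * xv m)) = (\<Sum>m=1..M. pim n m * (of_nat m * xv m))"
    using assms by (intro sum.mono_neutral_left) (auto simp: pim_eq_0)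
  with False show ?thesis
    by (simp add: Lam_def mult.assoc[symmetric] mps_const_inverse_of_nat_mult)
qed (simp add: pim_0)

text \<open>At fixed u, \<open>Lam n\<close> is linear in x, so the derivative reads off one
  coefficient, and \<open>V_Q_power_nth\<close> cancels the 1/n. In generating form, the sum over l
  of v^l \<open>dd l\<close> of the exponent is s V / (1 - s Q).\<close>

lemma dd_Lam:
  assumes "l \<ge> 1"
  shows "dd l (Lam n) = (if n = 0 then 0 else fps_nth (V * Q ^ (n - 1)) l)"
proof (cases "n = 0")
  case False
  have "of_nat n * dd l (Lam n) = dd l (of_nat n * Lam n)"
    by (rule derivation_of_nat_mult[OF derivation_dd, symmetric])
  \<comment> \<open>The upper limit is enlarged so that m = l surely occurs in the sum.\<close>
  also have "\<dots> = - (\<Sum>m=1..2*n+l. pim n m * (of_nat m * dd l (xv m)))"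
    unfolding of_nat_Lam[of n "2 * n + l", OF le_add1]
    by (simp add: derivation_uminus[OF derivation_dd] derivation_sum[OF derivation_dd]
        derivation_mult[OF derivation_dd] dd_pim[OF assms] derivation_of_nat[OF derivation_dd])
  also have "(\<Sum>m=1..2*n+l. pim n m * (of_nat m * dd l (xv m))) = (\<Sum>m=1..2*n+l. if m = l then pim n l * of_nat l else 0)"
    using assms by (intro sum.cong) (auto simp: dd_xv)
  also have "\<dots> = of_nat l * pim n l"
    using assms by (simp add: mult.commute)
  also have "- (of_nat l * pim n l) = of_nat n * fps_nth (V * Q ^ (n - 1)) l"
    by (simp add: V_Q_power_nth)
  finally show ?thesis
    using False mps_of_nat_cancel[of n] by simp
qed (simp add: derivation_0[OF derivation_dd])

definition pis :: "nat \<Rightarrow> mps fps" where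
  "pis i = Abs_fps (\<lambda>r. pim r i)"

lemma pis_0: "pis 0 = 1"
  by (rule fps_ext) (auto simp: pis_def pim_0 pim_eq_0_low)

lemma dd_H: "l \<ge> 1 \<Longrightarrow> fps_map (dd l) H = fps_map (dd l) (Abs_fps Lam) * H"
  using fps_map_expS[OF derivation_dd, of l Lam] by (simp add: H_def)

text \<open>The coefficient of v^i in v d/dv (1 - s Q)^(-1) = - (s V / (1 - s Q)) (1 - s Q)^(-1),
  where the bracket is the series from \<open>dd_Lam\<close>. This is the shape of recursion that
  \<open>opexp_ann_unique\<close> asks for.\<close>

lemma pis_recursion:
  "of_nat i * pis i = - (\<Sum>l=1..i. fps_map (dd l) (Abs_fps Lam) * pis (i - l))"
proof (rule fps_ext)
  fix N
  have "(\<Sum>l=1..i. \<Sum>n=0..N. dd l (Lam n) * pim (N - n) (i - l))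
      = (\<Sum>n=0..N. \<Sum>l=1..i. (if n = 0 then 0 else fps_nth (V * Q ^ (n - 1)) l) * pim (N - n) (i - l))"
    by (subst sum.swap) (simp add: dd_Lam)
  \<comment> \<open>The exponents n - 1 and N - n of Q add up to N - 1, so the convolution in v no
    longer depends on n.\<close>
  also have "\<dots> = (\<Sum>n=0..N. if n = 0 then 0 else fps_nth (V * Q ^ (N - 1)) i)"
  proof (rule sum.cong)
    fix n assume n: "n \<in> {0..N}"
    show "(\<Sum>l=1..i. (if n = 0 then 0 else fps_nth (V * Q ^ (n - 1)) l) * pim (N - n) (i - l))
        = (if n = 0 then 0 else fps_nth (V * Q ^ (N - 1)) i)"
    proof (cases "n = 0")
      case False
      have "V * Q ^ (N - 1) = (V * Q ^ (n - 1)) * Q ^ (N - n)"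
        using n False by (simp add: mult.assoc flip: power_add)
      then have "fps_nth (V * Q ^ (N - 1)) i
          = (\<Sum>l=0..i. fps_nth (V * Q ^ (n - 1)) l * pim (N - n) (i - l))"
        by (simp only: fps_mult_nth[of "V * Q ^ (n - 1)"] pim_def)
      also have "\<dots> = (\<Sum>l=1..i. fps_nth (V * Q ^ (n - 1)) l * pim (N - n) (i - l))"
        by (intro sum.mono_neutral_right) (auto simp: fps_mult_nth_0 not_less_eq_eq)
      finally show ?thesis
        using False by simp
    qed simp
  qed simp
  also have "\<dots> = of_nat N * fps_nth (V * Q ^ (N - 1)) i"
    by (simp add: sum.atLeast_Suc_atMost)
  finally show "fps_nth (of_nat i * pis i) N
      = fps_nth (- (\<Sum>l=1..i. fps_map (dd l) (Abs_fps Lam) * pis (i - l))) N"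
    by (simp add: pis_def fps_sum_nth fps_mult_nth[of "fps_map _ _"] V_Q_power_nth flip: fps_of_nat)
qed

text \<open>The inverse of \<open>\<Sum>\<^sub>i pis i v\<^sup>i\<close> is \<open>1 - s Q(v)\<close>.\<close>

definition pis_inv :: "nat \<Rightarrow> mps fps" where
  "pis_inv i = fps_const (fps_nth 1 i) - fps_const (fps_nth Q i) * fps_X"

text \<open>The same argument for v d/dv (1 - s Q) = s V = (s V / (1 - s Q)) (1 - s Q). On the right
  all powers of s cancel except the first.\<close>

lemma pis_inv_recursion:
  "of_nat i * pis_inv i = (\<Sum>l=1..i. fps_map (dd l) (Abs_fps Lam) * pis_inv (i - l))"
proof (rule fps_ext)
  fix N
  define E where "E n l = (if n = 0 then 0 else fps_nth (V * Q ^ (n - 1)) l)" for n l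
  have nth: "fps_nth (fps_map (dd l) (Abs_fps Lam) * pis_inv k) N
      = E N l * fps_nth 1 k - (if N = 0 then 0 else E (N - 1) l * fps_nth Q k)" if "l \<ge> 1" for l k
  proof -
    let ?F = "fps_map (dd l) (Abs_fps Lam)"
    have F: "fps_nth ?F n = E n l" for n
      using that by (simp add: dd_Lam E_def)
    have "?F * pis_inv k = fps_const (fps_nth 1 k) * ?F - fps_const (fps_nth Q k) * (fps_X * ?F)"
      unfolding pis_inv_def right_diff_distrib by (simp only: ac_simps)
    then have "fps_nth (?F * pis_inv k) N
        = fps_nth 1 k * fps_nth ?F N - fps_nth Q k * (if N = 0 then 0 else fps_nth ?F (N - 1))"
      by (simp only: fps_sub_nth fps_mult_left_const_nth fps_X_mult_nth)
    then show ?thesis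
      unfolding F by (cases "N = 0") (simp_all only: mult.commute if_True if_False mult_zero_left simp_thms)
  qed
  have "fps_nth (\<Sum>l=1..i. fps_map (dd l) (Abs_fps Lam) * pis_inv (i - l)) N
      = (\<Sum>l=1..i. E N l * fps_nth 1 (i - l)) - (if N = 0 then 0 else (\<Sum>l=1..i. E (N - 1) l * fps_nth Q (i - l)))"
    unfolding fps_sum_nth by (simp add: nth sum_subtractf)
  also have "(\<Sum>l=1..i. E N l * fps_nth 1 (i - l)) = E N i"
  proof -
    have "(\<Sum>l=1..i. E N l * fps_nth 1 (i - l)) = (\<Sum>l=1..i. if l = i then E N i else 0)"
      by (rule sum.cong) auto
    then show ?thesis
      by (cases "i = 0") (auto simp: E_def fps_mult_nth_0)
  qed
  also have "(\<Sum>l=1..i. E (N - 1) l * fps_nth Q (i - l)) = (if N \<le> 1 then 0 else E N i)"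
  proof (cases "N \<le> 1")
    case False
    then obtain k where k: "N = Suc (Suc k)"
      by (metis One_nat_def Suc_le_mono le0 not0_implies_Suc)
    have "V * Q ^ (N - 1) = (V * Q ^ (N - 2)) * Q"
      by (simp add: k mult.assoc mult.commute[of Q])
    then have "E N i = (\<Sum>l=0..i. fps_nth (V * Q ^ (N - 2)) l * fps_nth Q (i - l))"
      using False by (simp add: E_def fps_mult_nth[of "V * Q ^ (N - 2)"])
    also have "\<dots> = (\<Sum>l=1..i. fps_nth (V * Q ^ (N - 2)) l * fps_nth Q (i - l))"
      by (intro sum.mono_neutral_right) (auto simp: fps_mult_nth_0 not_less_eq_eq)
    finally show ?thesis
      using False by (simp add: E_def numeral_2_eq_2)
  qed (simp add: E_def)
  also have "E N i - (if N = 0 then 0 else if N \<le> 1 then 0 else E N i) = (if N = 1 then fps_nth V i else 0)"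
    by (simp add: E_def)
  also have "\<dots> = fps_nth (of_nat i * pis_inv i) N"
  proof -
    have "fps_nth V i = - (of_nat i * fps_nth Q i)"
      using V_Q_power_nth[of i 1] by (simp add: pim_def)
    then show ?thesis
      by (cases "i = 0") (auto simp: pis_inv_def simp flip: fps_of_nat)
  qed
  finally show "fps_nth (of_nat i * pis_inv i) N
      = fps_nth (\<Sum>l=1..i. fps_map (dd l) (Abs_fps Lam) * pis_inv (i - l)) N" ..
qed

section \<open>Schur polynomials of u and -u at integer indices\<close>

definition SS :: "int \<Rightarrow> mps" where
  "SS c = (if c < 0 then 0 else schur (nat c) uv)"

definition SM :: "int \<Rightarrow> mps" where
  "SM c = (if c < 0 then 0 else schur (nat c) (\<lambda>n. - uv n))"

lemma SS_neg [simp]: "c < 0 \<Longrightarrow> SS c = 0" and SM_neg [simp]: "c < 0 \<Longrightarrow> SM c = 0"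
  by (simp_all add: SS_def SM_def)

lemma SS_0 [simp]: "SS 0 = 1" and SM_0 [simp]: "SM 0 = 1" and SS_1 [simp]: "SS 1 = u1"
  by (simp_all add: SS_def SM_def u1_def schur_1)

lemma dx_SM:
  assumes "l \<ge> 1"
  shows "dx l (SM c) = - SM (c - int l)"
proof -
  have "fps_map (dx l) (tser (\<lambda>n. - uv n)) = - (fps_X ^ l)"
    using assms by (intro fps_ext)
      (auto simp: dx_uv derivation_0[OF derivation_dx] derivation_uminus[OF derivation_dx])
  then have "fps_map (dx l) (expS (\<lambda>n. - uv n)) = - (fps_X ^ l * expS (\<lambda>n. - uv n))"
    by (simp add: fps_map_expS[OF derivation_dx])
  then have "dx l (fps_nth (expS (\<lambda>n. - uv n)) n) = fps_nth (- (fps_X ^ l * expS (\<lambda>n. - uv n))) n" for n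
    by (metis fps_map_nth)
  then have "dx l (schur (nat c) (\<lambda>n. - uv n)) = - (if nat c < l then 0 else schur (nat c - l) (\<lambda>n. - uv n))"
    by (simp add: expS_def fps_X_power_mult_nth)
  then show ?thesis
    using assms by (auto simp: SM_def derivation_0[OF derivation_dx] nat_diff_distrib)
qed

lemma derivation_schur_eq_0:
  assumes "derivation d" "\<And>n. n \<ge> 1 \<Longrightarrow> d (t n) = 0"
  shows "d (schur k t) = 0"
proof -
  have "fps_map d (tser t) = 0"
    using assms by (intro fps_ext) (auto simp: derivation_0)
  then have "fps_map d (expS t) = 0"
    by (simp add: fps_map_expS[OF assms(1)])
  from arg_cong[OF this, of "\<lambda>f. fps_nth f k"] show ?thesis
    by (simp add: expS_def)
qed

lemma dd_SM: "l \<ge> 1 \<Longrightarrow> dd l (SM c) = 0"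
  by (auto simp: SM_def derivation_0[OF derivation_dd] dd_uv derivation_uminus[OF derivation_dd]
      intro!: derivation_schur_eq_0[OF derivation_dd])

lemma fps_deriv_eq_0_mps:
  fixes F :: "mps fps"
  assumes "fps_deriv F = 0"
  shows "F = fps_const (fps_nth F 0)"
proof (rule fps_ext)
  fix n
  show "fps_nth F n = fps_nth (fps_const (fps_nth F 0)) n"
  proof (cases n)
    case (Suc k)
    have "of_nat (Suc k) * fps_nth F (Suc k) = of_nat (Suc k) * 0"
      using arg_cong[OF assms, of "\<lambda>f. fps_nth f k"] by simp
    then have "fps_nth F (Suc k) = 0"
      by (rule mps_of_nat_cancel) simp
    then show ?thesis
      by (simp add: Suc)
  qed simp
qed

lemma expS_mult_uminus: "expS t * expS (\<lambda>n. - t n) = 1"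
proof -
  let ?t = "\<lambda>n. - t n"
  have "tser ?t = - tser t"
    by (rule fps_ext) simp
  then have "fps_deriv (expS t * expS ?t) = 0"
    by (simp add: expS_deriv[of t] expS_deriv[of ?t] algebra_simps)
  from fps_deriv_eq_0_mps[OF this] show ?thesis
    by (simp add: expS_def fps_mult_nth_0)
qed

text \<open>A positive coefficient of exp(U) exp(-U) = 1. The k surplus terms have a negative index
  in \<open>SM\<close>, which leaves the upper limit to the caller.\<close>

lemma SS_SM_convolution:
  assumes "c \<ge> 1"
  shows "(\<Sum>i=0..nat c + k. SS (int i) * SM (c - int i)) = 0"
proof -
  have "(\<Sum>i=0..nat c + k. SS (int i) * SM (c - int i)) = (\<Sum>i=0..nat c. SS (int i) * SM (c - int i))"
    by (rule sum.mono_neutral_right) auto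
  also have "\<dots> = fps_nth (expS uv * expS (\<lambda>n. - uv n)) (nat c)"
    unfolding fps_mult_nth
    using assms by (intro sum.cong) (auto simp: SS_def SM_def expS_def nat_diff_distrib)
  also have "\<dots> = 0"
    using assms by (simp add: expS_mult_uminus)
  finally show ?thesis .
qed

text \<open>
  \<open>pr q c K\<close> is the coefficient of $z^c$ in $\exp(\sum u_n z^n)\, q(1/z)$ when \<open>q\<close> has degree at
  most \<open>K\<close>.
\<close>

definition pr :: "mps fps \<Rightarrow> int \<Rightarrow> nat \<Rightarrow> mps" where
  "pr q c K = (\<Sum>i\<le>K. SS (c + int i) * fps_nth q i)"

definition deg_le :: "mps fps \<Rightarrow> nat \<Rightarrow> bool" where
  "deg_le q K \<longleftrightarrow> (\<forall>i>K. fps_nth q i = 0)"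

lemma pr_bound: "deg_le q K \<Longrightarrow> K \<le> K' \<Longrightarrow> pr q c K' = pr q c K"
  unfolding pr_def deg_le_def by (intro sum.mono_neutral_right) auto

lemma pr_add: "pr (p + q) c K = pr p c K + pr q c K"
  and pr_diff: "pr (p - q) c K = pr p c K - pr q c K"
  by (simp_all add: pr_def sum.distrib sum_subtractf algebra_simps)

lemma pr_const_mult: "pr (fps_const a * q) c K = a * pr q c K"
  and pr_uminus: "pr (- q) c K = - pr q c K"
  by (simp_all add: pr_def sum_distrib_left sum_negf mult.left_commute)

lemma pr_X: "pr (fps_X * q) c (Suc K) = pr q (c + 1) K"
  unfolding pr_def by (subst sum.atMost_Suc_shift) (simp add: algebra_simps)

lemma pr_mult:
  assumes "deg_le q K" "deg_le d M"
  shows "(\<Sum>m\<le>M. pr q (c + int m) K * fps_nth d m) = pr (q * d) c (K + M)"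
proof -
  let ?f = "\<lambda>i m. SS (c + int (i + m)) * fps_nth q i * fps_nth d m"
  have "pr (q * d) c (K + M) = (\<Sum>k\<le>K + M. \<Sum>i\<le>k. ?f i (k - i))"
    by (simp add: pr_def fps_mult_nth sum_distrib_left atMost_atLeast0 mult.assoc)
  also have "\<dots> = (\<Sum>(i, m)\<in>{(i, m). i + m \<le> K + M}. ?f i m)"
    by (rule sum.triangle_reindex_eq[symmetric])
  also have "\<dots> = (\<Sum>(i, m)\<in>{..K} \<times> {..M}. ?f i m)"
  proof (rule sum.mono_neutral_right)
    have "{(i::nat, m). i + m \<le> K + M} \<subseteq> {..K + M} \<times> {..K + M}"
      by auto
    then show "finite {(i::nat, m). i + m \<le> K + M}"
      by (rule finite_subset) simp
    have zero: "?f i m = 0" if "i > K \<or> m > M" for i m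
      using that assms by (auto simp: deg_le_def)
    show "\<forall>p\<in>{(i, m). i + m \<le> K + M} - {..K} \<times> {..M}. (case p of (i, m) \<Rightarrow> ?f i m) = 0"
    proof
      fix p :: "nat \<times> nat" assume p: "p \<in> {(i, m). i + m \<le> K + M} - {..K} \<times> {..M}"
      obtain i m where im: "p = (i, m)"
        by (rule prod.exhaust)
      with p have "i > K \<or> m > M"
        by (simp add: not_le)
      from zero[OF this] show "(case p of (i, m) \<Rightarrow> ?f i m) = 0"
        by (simp only: im prod.case)
    qed
  qed auto
  also have "\<dots> = (\<Sum>m\<le>M. \<Sum>i\<le>K. ?f i m)"
    unfolding sum.cartesian_product[symmetric] by (rule sum.swap)
  also have "\<dots> = (\<Sum>m\<le>M. pr q (c + int m) K * fps_nth d m)"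
    by (simp add: pr_def sum_distrib_right add.assoc add.commute[of "int _" "int _"])
  finally show ?thesis ..
qed

lemma deg_le_mult:
  assumes "deg_le p K" "deg_le q M"
  shows "deg_le (p * q) (K + M)"
  unfolding deg_le_def
proof (intro allI impI)
  fix i assume i: "i > K + M"
  have "fps_nth p l * fps_nth q (i - l) = 0" for l
    using assms i by (cases "l > K") (auto simp: deg_le_def)
  then show "fps_nth (p * q) i = 0"
    by (simp add: fps_mult_nth)
qed

lemma deg_le_Q_power: "deg_le (Q ^ r) (2 * r)"
  using pim_eq_0[of r] by (simp add: deg_le_def pim_def)

lemma deg_le_V: "deg_le V 2"
  unfolding deg_le_def V_def mult_2 by (auto simp: fps_X_power_nth fps_X_nth)

text \<open>The coefficient of z^c in exp(sum u_n z^n) Q(1/z)^r. Summed against s^r it pairs the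
  creation exponential of phi_star with the factor 1 / (1 - s Q(1/z)) that the translation puts on
  H.\<close>

definition Y :: "nat \<Rightarrow> int \<Rightarrow> mps" where
  "Y r c = pr (Q ^ r) c (2 * r)"

lemma Y_eq: "2 * r \<le> K \<Longrightarrow> Y r c = pr (Q ^ r) c K"
  unfolding Y_def by (rule pr_bound[OF deg_le_Q_power, symmetric])

lemma Y_0: "Y 0 c = SS c"
  by (simp add: Y_def pr_def)

lemma Y_Suc: "Y (Suc r) c = - (u1 * Y r (c + 1) + Y r (c + 2))"
proof -
  have "Q ^ Suc r = - (fps_const u1 * (fps_X * Q ^ r)) - fps_X * (fps_X * Q ^ r)"
    by (simp add: Q_def power2_eq_square algebra_simps)
  then have "Y (Suc r) c = pr (- (fps_const u1 * (fps_X * Q ^ r)) - fps_X * (fps_X * Q ^ r)) c (Suc (Suc (2 * r)))"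
    by (simp add: Y_def)
  also have "\<dots> = - (u1 * pr (fps_X * Q ^ r) c (Suc (Suc (2 * r)))) - pr (fps_X * (fps_X * Q ^ r)) c (Suc (Suc (2 * r)))"
    by (simp only: pr_diff pr_uminus pr_const_mult)
  also have "pr (fps_X * (fps_X * Q ^ r)) c (Suc (Suc (2 * r))) = Y r (c + 1 + 1)"
    by (simp only: pr_X Y_def)
  also have "pr (fps_X * Q ^ r) c (Suc (Suc (2 * r))) = Y r (c + 1)"
    unfolding pr_X by (rule Y_eq[symmetric]) simp
  finally show ?thesis
    by (simp add: add.assoc)
qed

text \<open>Coefficient of s^N in \<open>YF (2 - m)\<close> + s \<open>pis (m - 1)\<close>
  \<open>YF 3\<close> - \<open>pis m\<close> \<open>YF 2\<close> = - \<open>pis m\<close> / s. Both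
  families obey the three-term recurrence of 1 + s (u_1 v + v^2); the inhomogeneous term
  \<open>SS (2 - m)\<close> is nonzero only for m = 1, 2, which are the special cases. Each use of
  the recurrence costs one power of s, so the induction runs on \<open>N\<close> for all
  \<open>m\<close> at once.\<close>

lemma Y_pim_identity:
  assumes "m \<ge> 1"
  shows "Y N (2 - int m) + (\<Sum>n<N. pim n (m - 1) * Y (N - Suc n) 3 - pim (Suc n) m * Y (N - Suc n) 2)
    = - pim (Suc N) m"
  using assms
proof (induction N arbitrary: m)
  case 0
  consider "m = 1" | "m = 2" | "m > 2"
    using 0 by linarith
  then show ?case
    by cases (auto simp: Y_0 pim_Suc pim_0)
next
  case (Suc N)
  define g where "g m = (\<Sum>n<N. pim n (m - 1) * Y (N - Suc n) 3 - pim (Suc n) m * Y (N - Suc n) 2)" for m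
  have IH: "Y N (2 - int m) = - pim (Suc N) m - g m" if "m \<ge> 1" for m
    using Suc.IH[OF that] by (simp add: g_def eq_diff_eq)
  \<comment> \<open>What is left of the sum after splitting off n = 0. Each \<open>pim\<close> here
    has a positive first index, so \<open>pim_Suc\<close> reduces it to \<open>g\<close> at m - 1
    and m - 2.\<close>
  define g' where "g' m = (\<Sum>n<N. pim (Suc n) (m - 1) * Y (N - Suc n) 3 - pim (Suc (Suc n)) m * Y (N - Suc n) 2)" for m
  have step: "(\<Sum>n<Suc N. pim n (m - 1) * Y (Suc N - Suc n) 3 - pim (Suc n) m * Y (Suc N - Suc n) 2)
      = pim 0 (m - 1) * Y N 3 - pim (Suc 0) m * Y N 2 + g' m" for m
    unfolding g'_def by (subst sum.lessThan_Suc_shift) simp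
  consider "m = 1" | "m = 2" | k where "m = Suc (Suc (Suc k))"
    using Suc.prems by (metis One_nat_def Suc_1 le_0_eq not0_implies_Suc not_one_le_zero)
  then show ?case
  proof cases
    case 1
    have "g' 1 = 0"
      unfolding g'_def by (rule sum.neutral) (auto simp: pim_Suc)
    with 1 show ?thesis
      unfolding step by (simp add: Y_Suc pim_Suc pim_0)
  next
    case 2
    have "g' 2 = - (u1 * g 1)"
      unfolding g'_def g_def sum_distrib_left sum_negf[symmetric]
      by (rule sum.cong) (simp_all add: pim_Suc[of _ "Suc 0"] pim_Suc[of "Suc _" 2] pim_Suc[of _ 0] algebra_simps)
    moreover have Y1: "Y N 1 = - pim (Suc N) (Suc 0) - g (Suc 0)"
      using IH[of 1] by simp
    ultimately show ?thesis
      unfolding step 2 by (simp add: Y1 Y_Suc pim_0 pim_Suc[of "Suc N" 2] pim_Suc[of N 0] pim_Suc[of 0] algebra_simps)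
  next
    case 3
    have "g' m = - (u1 * g (m - 1) + g (m - 2))"
      unfolding g'_def g_def sum_distrib_left sum.distrib[symmetric] sum_negf[symmetric]
      by (rule sum.cong) (simp_all add: 3 pim_Suc[of _ "Suc (Suc k)"] pim_Suc[of "Suc _" "Suc (Suc (Suc k))"] algebra_simps)
    moreover have Y2: "Y N (- int k) = - pim (Suc N) (Suc (Suc k)) - g (Suc (Suc k))"
      and Y1: "Y N (1 - int k) = - pim (Suc N) (Suc k) - g (Suc k)"
      using IH[of "Suc (Suc k)"] IH[of "Suc k"] by simp_all
    ultimately show ?thesis
      unfolding step 3 by (simp add: Y1 Y2 Y_Suc pim_0 pim_Suc[of "Suc N" "Suc (Suc (Suc k))"] pim_Suc[of 0] algebra_simps)
  qed
qed

lemma V_plus_Q: "V + Q = fps_X * fps_X"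
  by (simp add: V_def Q_def power2_eq_square)

text \<open>By \<open>pr_mult\<close> the inner sum pairs the creation exponential with Q^(N-1-n) V
  Q^n = V Q^(N-1), so all N inner sums agree. Then V = v^2 - Q gives V Q^(N-1) = v^2 Q^(N-1) -
  Q^N.\<close>

lemma Y_V_identity:
  assumes "2 * N \<le> M"
  shows "of_nat N * Y N 2 - of_nat N * Y (N - 1) 4
    + (\<Sum>n<N. \<Sum>m=1..M. Y (N - Suc n) (int m + 2) * fps_nth (V * Q ^ n) m) = 0"
proof (cases N)
  case (Suc N')
  have "(\<Sum>m=1..M. Y (N - Suc n) (int m + 2) * fps_nth (V * Q ^ n) m) = pr (V * Q ^ N') 2 (Suc (Suc (2 * N')))"
    if "n < N" for n
  proof -
    have deg: "deg_le (V * Q ^ n) (2 * Suc n)"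
      using deg_le_mult[OF deg_le_V deg_le_Q_power[of n]] by simp
    have "Q ^ (N - Suc n) * (V * Q ^ n) = V * (Q ^ (N - Suc n) * Q ^ n)"
      by (simp only: ac_simps)
    also have "\<dots> = V * Q ^ N'"
      using that Suc by (simp flip: power_add)
    finally have eq: "Q ^ (N - Suc n) * (V * Q ^ n) = V * Q ^ N'" .
    have "(\<Sum>m=1..M. Y (N - Suc n) (int m + 2) * fps_nth (V * Q ^ n) m)
        = (\<Sum>m\<le>2 * Suc n. Y (N - Suc n) (2 + int m) * fps_nth (V * Q ^ n) m)"
      using assms that deg
      by (intro sum.mono_neutral_cong) (auto simp: deg_le_def fps_mult_nth_0 not_less_eq_eq add.commute)
    also have "\<dots> = pr (Q ^ (N - Suc n) * (V * Q ^ n)) 2 (2 * (N - Suc n) + 2 * Suc n)"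
      unfolding Y_def by (rule pr_mult[OF deg_le_Q_power deg])
    also have "2 * (N - Suc n) + 2 * Suc n = Suc (Suc (2 * N'))"
      using that Suc by simp
    finally show ?thesis
      unfolding eq .
  qed
  then have "(\<Sum>n<N. \<Sum>m=1..M. Y (N - Suc n) (int m + 2) * fps_nth (V * Q ^ n) m)
      = of_nat N * pr (V * Q ^ N') 2 (Suc (Suc (2 * N')))"
    by simp
  moreover have "pr (V * Q ^ N') 2 (Suc (Suc (2 * N'))) = Y N' 4 - Y N 2"
  proof -
    have "V * Q ^ N' + Q ^ N = fps_X * (fps_X * Q ^ N')"
      using arg_cong[OF V_plus_Q, of "\<lambda>f. f * Q ^ N'"] by (simp add: Suc algebra_simps)
    then have "pr (V * Q ^ N') 2 (Suc (Suc (2 * N'))) + pr (Q ^ N) 2 (Suc (Suc (2 * N')))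
        = pr (Q ^ N') (2 + 1 + 1) (2 * N')"
      unfolding pr_add[symmetric] by (simp only: pr_X)
    moreover have "pr (Q ^ N) 2 (Suc (Suc (2 * N'))) = Y N 2"
      by (rule Y_eq[symmetric]) (simp add: Suc)
    ultimately have "pr (V * Q ^ N') 2 (Suc (Suc (2 * N'))) + Y N 2 = Y N' 4"
      by (simp add: Y_def[of N'])
    then show ?thesis
      by (simp only: eq_diff_eq)
  qed
  ultimately show ?thesis
    by (simp only: Suc diff_Suc_1 right_diff_distrib) simp
qed simp

text \<open>The variables y enter \<open>Lam\<close> only through u_1. Since \<open>dx\<close> is
  \<open>dd\<close> plus \<open>dy\<close>, this is the part of the x-derivative that comes from
  moving u.\<close>

lemma dy_Lam:
  assumes "m \<ge> 1" "2 * n \<le> M" "n > 0"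
  shows "dy m (Lam n) = (if m = 1 then \<Sum>k=1..M. pim (n - 1) (k - 1) * (of_nat k * xv k) else 0)"
proof -
  have u1: "dy m u1 = (if m = 1 then 1 else 0)"
    using assms(1) by (simp add: u1_def uv_def derivation_add[OF derivation_dy] dy_xv dy_yv)
  have "of_nat n * dy m (Lam n) = dy m (of_nat n * Lam n)"
    by (rule derivation_of_nat_mult[OF derivation_dy, symmetric])
  also have "\<dots> = - (\<Sum>k=1..M. dy m (pim n k) * (of_nat k * xv k))"
    unfolding of_nat_Lam[OF assms(2)]
    by (simp add: derivation_uminus[OF derivation_dy] derivation_sum[OF derivation_dy]
        derivation_mult[OF derivation_dy] dy_xv derivation_of_nat[OF derivation_dy])
  also have "\<dots> = (\<Sum>k=1..M. of_nat n * dy m u1 * pim (n - 1) (k - 1) * (of_nat k * xv k))"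
    unfolding sum_negf[symmetric]
    by (rule sum.cong) (auto simp: derivation_pim[OF derivation_dy])
  also have "\<dots> = of_nat n * (dy m u1 * (\<Sum>k=1..M. pim (n - 1) (k - 1) * (of_nat k * xv k)))"
    by (simp add: sum_distrib_left mult.assoc)
  finally show ?thesis
    using mps_of_nat_cancel[OF _ assms(3)] u1 by simp
qed

text \<open>The coefficient of s^N in a differential equation in s for the exponent of H. The groups
  are, in order: multiplication by x in the current, its derivative of the translation factor, its
  derivative of H, and two terms of s (\<open>YF 2\<close> H)' / H. After writing \<open>dx\<close>
  as \<open>dd\<close> plus \<open>dy\<close>, the terms free of x cancel by
  \<open>Y_V_identity\<close>, and the coefficient of m x_m is
  \<open>Y_pim_identity\<close>.\<close>

lemma Lam_identity:
  assumes M: "2 * N + 2 \<le> M"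
  shows "(\<Sum>m=1..M. of_nat m * xv m * Y N (2 - int m)) - of_nat N * Y (N - 1) 4
      + (\<Sum>m=1..M. \<Sum>n<N. Y (N - Suc n) (int m + 2) * dx m (Lam (Suc n)))
      + of_nat N * Y N 2 + (\<Sum>n<N. Y (N - Suc n) 2 * (of_nat (Suc n) * Lam (Suc n)))
    = of_nat (Suc N) * Lam (Suc N)"
proof -
  let ?x = "\<lambda>m. of_nat m * xv m"
  have dx: "dx m (Lam (Suc n)) = fps_nth (V * Q ^ n) m + (if m = 1 then \<Sum>k=1..M. pim n (k - 1) * ?x k else 0)"
    if "m \<ge> 1" "n < N" for m n
  proof -
    have "dx m (Lam (Suc n)) = dd m (Lam (Suc n)) + dy m (Lam (Suc n))"
      by (simp add: dd_def)
    then show ?thesis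
      using dy_Lam[of m "Suc n" M] that M dd_Lam[of m "Suc n"] by simp
  qed
  have "(\<Sum>m=1..M. \<Sum>n<N. Y (N - Suc n) (int m + 2) * dx m (Lam (Suc n)))
      = (\<Sum>m=1..M. \<Sum>n<N. Y (N - Suc n) (int m + 2) * fps_nth (V * Q ^ n) m)
        + (\<Sum>m=1..M. if m = 1 then \<Sum>n<N. Y (N - Suc n) 3 * (\<Sum>k=1..M. pim n (k - 1) * ?x k) else 0)"
    unfolding sum.distrib[symmetric] by (rule sum.cong) (auto simp: dx algebra_simps sum.distrib)
  also have "\<dots> = (\<Sum>n<N. \<Sum>m=1..M. Y (N - Suc n) (int m + 2) * fps_nth (V * Q ^ n) m)
        + (\<Sum>n<N. Y (N - Suc n) 3 * (\<Sum>k=1..M. pim n (k - 1) * ?x k))"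
    using M by (subst sum.swap) simp
  also have "(\<Sum>n<N. \<Sum>m=1..M. Y (N - Suc n) (int m + 2) * fps_nth (V * Q ^ n) m)
      = of_nat N * Y (N - 1) 4 - of_nat N * Y N 2"
    using Y_V_identity[of N M] M by (simp add: add_eq_0_iff)
  also have "(\<Sum>n<N. Y (N - Suc n) 3 * (\<Sum>k=1..M. pim n (k - 1) * ?x k))
      = (\<Sum>k=1..M. ?x k * (\<Sum>n<N. pim n (k - 1) * Y (N - Suc n) 3))"
    by (simp add: sum_distrib_left sum.swap[of _ "{..<N}"] ac_simps)
  finally have 1: "(\<Sum>m=1..M. \<Sum>n<N. Y (N - Suc n) (int m + 2) * dx m (Lam (Suc n)))
      = of_nat N * Y (N - 1) 4 - of_nat N * Y N 2 + (\<Sum>k=1..M. ?x k * (\<Sum>n<N. pim n (k - 1) * Y (N - Suc n) 3))" .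
  have "(\<Sum>n<N. Y (N - Suc n) 2 * (of_nat (Suc n) * Lam (Suc n)))
      = (\<Sum>n<N. Y (N - Suc n) 2 * - (\<Sum>k=1..M. pim (Suc n) k * ?x k))"
    using M by (intro sum.cong refl) (subst of_nat_Lam[where M = M], auto)
  also have "\<dots> = - (\<Sum>k=1..M. ?x k * (\<Sum>n<N. pim (Suc n) k * Y (N - Suc n) 2))"
    by (simp add: sum_distrib_left sum.swap[of _ "{..<N}"] sum_negf ac_simps)
  finally have 2: "(\<Sum>n<N. Y (N - Suc n) 2 * (of_nat (Suc n) * Lam (Suc n)))
      = - (\<Sum>k=1..M. ?x k * (\<Sum>n<N. pim (Suc n) k * Y (N - Suc n) 2))" .
  have "(\<Sum>m=1..M. ?x m * Y N (2 - int m)) + (\<Sum>k=1..M. ?x k * (\<Sum>n<N. pim n (k - 1) * Y (N - Suc n) 3))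
      - (\<Sum>k=1..M. ?x k * (\<Sum>n<N. pim (Suc n) k * Y (N - Suc n) 2))
      = (\<Sum>m=1..M. ?x m * (Y N (2 - int m)
          + (\<Sum>n<N. pim n (m - 1) * Y (N - Suc n) 3 - pim (Suc n) m * Y (N - Suc n) 2)))"
    by (simp add: sum.distrib[symmetric] sum_subtractf[symmetric] algebra_simps)
      (simp add: sum_subtractf algebra_simps)
  also have "\<dots> = (\<Sum>m=1..M. ?x m * - pim (Suc N) m)"
    by (intro sum.cong refl) (subst Y_pim_identity, auto)
  also have "\<dots> = of_nat (Suc N) * Lam (Suc N)"
    using M by (subst of_nat_Lam[where M = M]) (auto simp: sum_negf ac_simps)
  finally show ?thesis
    unfolding 1 2 by (simp add: algebra_simps)
qed

lemma sum_shift_1: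
  fixes f :: "nat \<Rightarrow> mps"
  shows "(\<Sum>m=1..M. f (Suc m)) = (\<Sum>m=1..M. f m) - f 1 + f (Suc M)"
  by (induction M) simp_all

section \<open>Exponentials of commuting operators\<close>

text \<open>The coefficient of w^i in the m-th power of the sum of A_l w^l over l >= 1. The
  operators act on \<open>mps\<close> because the exponentials never mix powers of p.\<close>

fun oppow :: "(nat \<Rightarrow> mps \<Rightarrow> mps) \<Rightarrow> nat \<Rightarrow> nat \<Rightarrow> mps \<Rightarrow> mps" where
  "oppow A 0 i f = (if i = 0 then f else 0)"
| "oppow A (Suc m) i f = (\<Sum>l=1..i. A l (oppow A m (i - l) f))"

text \<open>The coefficient of $w^i$ in $\exp(\sum_{l\ge1} A_l w^l)$.\<close>

definition opexp :: "(nat \<Rightarrow> mps \<Rightarrow> mps) \<Rightarrow> nat \<Rightarrow> mps \<Rightarrow> mps" where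
  "opexp A i f = (\<Sum>m\<le>i. mps_const (1 / fact m) * oppow A m i f)"

lemma oppow_eq_0:
  assumes "\<And>l. A l 0 = 0" "i < m"
  shows "oppow A m i f = 0"
  using assms(2) by (induction m arbitrary: i) (auto simp: assms(1) intro!: sum.neutral)

lemma oppow_0_right: "(\<And>l. A l 0 = 0) \<Longrightarrow> oppow A m i 0 = 0"
  by (induction m arbitrary: i) auto

lemma opexp_0_right: "(\<And>l. A l 0 = 0) \<Longrightarrow> opexp A i 0 = 0"
  by (simp add: opexp_def oppow_0_right)

lemma oppow_mult: "oppow (\<lambda>l g. t l * g) m i f = fps_nth (tser t ^ m) i * f"
proof (induction m arbitrary: i)
  case (Suc m)
  have "fps_nth (tser t ^ Suc m) i = (\<Sum>l=0..i. (if l = 0 then 0 else t l) * fps_nth (tser t ^ m) (i - l))"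
    by (simp add: fps_mult_nth)
  also have "\<dots> = (\<Sum>l=1..i. t l * fps_nth (tser t ^ m) (i - l))"
    by (intro sum.mono_neutral_cong_right) auto
  finally show ?case
    by (simp add: Suc sum_distrib_right mult.assoc)
qed simp

lemma opexp_mult: "opexp (\<lambda>l g. t l * g) i f = schur i t * f"
  by (simp add: opexp_def oppow_mult schur_def sum_distrib_right mult.assoc)

lemma sum_swap_triangle:
  fixes F :: "nat \<Rightarrow> nat \<Rightarrow> mps"
  shows "(\<Sum>l=1..i. \<Sum>k=1..i-l. F l k) = (\<Sum>k=1..i. \<Sum>l=1..i-k. F l k)"
proof -
  have "(\<Sum>p\<in>(SIGMA l:{1..i}. {1..i - l}). F (fst p) (snd p)) = (\<Sum>p\<in>(SIGMA k:{1..i}. {1..i - k}). F (snd p) (fst p))"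
    by (rule sum.reindex_bij_witness[where i = prod.swap and j = prod.swap]) auto
  then show ?thesis
    by (simp add: sum.Sigma case_prod_unfold)
qed

text \<open>Apply w d/dw to exp(A(w)); commutativity lets w A'(w) be moved to the front of every
  power.\<close>

lemma opexp_recursion:
  assumes add: "\<And>l f g. A l (f + g) = A l f + A l g"
    and scale: "\<And>l c f. A l (mps_const c * f) = mps_const c * A l f"
    and commute: "\<And>l k f. A l (A k f) = A k (A l f)"
  shows "of_nat i * opexp A i f = (\<Sum>l=1..i. of_nat l * A l (opexp A (i - l) f))"
proof -
  have zero: "A l 0 = 0" for l
    using scale[of l 0 0] by simp
  have A_sum: "A l (\<Sum>i\<in>S. h i) = (\<Sum>i\<in>S. A l (h i))" for l S and h :: "nat \<Rightarrow> mps"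
    by (induction S rule: infinite_finite_induct) (simp_all add: zero add)
  have A_of_nat: "A l (of_nat n * g) = of_nat n * A l g" for l n g
    using scale[of l "of_nat n" g] by simp
  have pow: "of_nat i * oppow A (Suc m) i f = of_nat (Suc m) * (\<Sum>l=1..i. of_nat l * A l (oppow A m (i - l) f))" for m i
  proof (induction m arbitrary: i)
    case 0
    show ?case
      by (auto simp: sum_distrib_left zero intro!: sum.cong)
  next
    case (Suc m)
    have "of_nat i * oppow A (Suc (Suc m)) i f = (\<Sum>l=1..i. of_nat i * A l (oppow A (Suc m) (i - l) f))"
      by (simp only: oppow.simps(2)[of A "Suc m"] sum_distrib_left)
    also have "\<dots> = (\<Sum>l=1..i. of_nat l * A l (oppow A (Suc m) (i - l) f) + A l (of_nat (i - l) * oppow A (Suc m) (i - l) f))"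
    proof (rule sum.cong)
      fix l assume "l \<in> {1..i}"
      then have "of_nat i = (of_nat l + of_nat (i - l) :: mps)"
        by (simp flip: of_nat_add)
      then show "of_nat i * A l (oppow A (Suc m) (i - l) f)
          = of_nat l * A l (oppow A (Suc m) (i - l) f) + A l (of_nat (i - l) * oppow A (Suc m) (i - l) f)"
        by (simp only: A_of_nat distrib_right)
    qed simp
    also have "\<dots> = (\<Sum>l=1..i. of_nat l * A l (oppow A (Suc m) (i - l) f))
        + of_nat (Suc m) * (\<Sum>l=1..i. \<Sum>k=1..i-l. of_nat k * A l (A k (oppow A m (i - l - k) f)))"
      unfolding Suc.IH by (simp only: sum.distrib A_of_nat A_sum sum_distrib_left)
    also have "(\<Sum>l=1..i. \<Sum>k=1..i-l. of_nat k * A l (A k (oppow A m (i - l - k) f)))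
        = (\<Sum>k=1..i. \<Sum>l=1..i-k. of_nat k * A l (A k (oppow A m (i - l - k) f)))"
      by (rule sum_swap_triangle)
    also have "\<dots> = (\<Sum>k=1..i. of_nat k * A k (oppow A (Suc m) (i - k) f))"
      by (simp add: A_sum sum_distrib_left commute add.commute)
    finally show ?case
      by (simp add: distrib_right)
  qed
  \<comment> \<open>Raising the limit to \<open>Suc i\<close> adds a zero term; the term m = 0
    vanishes too, so after the shift m again runs up to i.\<close>
  have "of_nat i * opexp A i f = (\<Sum>m\<le>Suc i. mps_const (1 / fact m) * (of_nat i * oppow A m i f))"
    by (simp add: opexp_def sum_distrib_left oppow_eq_0[of A, OF zero] mult.left_commute del: oppow.simps)
  also have "\<dots> = (\<Sum>m\<le>i. mps_const (1 / fact (Suc m)) * (of_nat i * oppow A (Suc m) i f))"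
    by (subst sum.atMost_Suc_shift) simp
  also have "\<dots> = (\<Sum>m\<le>i. mps_const (1 / fact m) * (\<Sum>l=1..i. of_nat l * A l (oppow A m (i - l) f)))"
  proof (rule sum.cong)
    fix m
    have "mps_const (1 / fact (Suc m)) * of_nat (Suc m) = mps_const (1 / fact m)"
      unfolding mps_const_of_nat[symmetric] mps_const_mult[symmetric]
      by (simp add: divide_simps del: of_nat_Suc)
    then show "mps_const (1 / fact (Suc m)) * (of_nat i * oppow A (Suc m) i f)
        = mps_const (1 / fact m) * (\<Sum>l=1..i. of_nat l * A l (oppow A m (i - l) f))"
      unfolding pow by (simp only: mult.assoc[symmetric])
  qed simp
  also have "\<dots> = (\<Sum>l=1..i. of_nat l * A l (\<Sum>m\<le>i. mps_const (1 / fact m) * oppow A m (i - l) f))"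
    by (simp only: A_sum scale sum_distrib_left sum.swap[of _ "{..i}"] mult.left_commute)
  also have "\<dots> = (\<Sum>l=1..i. of_nat l * A l (opexp A (i - l) f))"
  proof (intro sum.cong refl arg_cong[where f = "\<lambda>x. of_nat _ * A _ x"])
    fix l
    show "(\<Sum>m\<le>i. mps_const (1 / fact m) * oppow A m (i - l) f) = opexp A (i - l) f"
      unfolding opexp_def by (intro sum.mono_neutral_right) (auto simp: oppow_eq_0[of A, OF zero])
  qed
  finally show ?thesis .
qed

lemma opexp_0: "opexp A 0 f = f"
  by (simp add: opexp_def)

text \<open>The factor i can be cancelled, so the recursion fixes each coefficient from the earlier
  ones: computing an exponential reduces to checking a candidate.\<close>

lemma opexp_unique:
  assumes "\<And>l f g. A l (f + g) = A l f + A l g"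
    and "\<And>l c f. A l (mps_const c * f) = mps_const c * A l f"
    and "\<And>l k f. A l (A k f) = A k (A l f)"
    and e0: "e 0 = f" and e: "\<And>i. of_nat i * e i = (\<Sum>l=1..i. of_nat l * A l (e (i - l)))"
  shows "opexp A i f = e i"
proof (induction i rule: less_induct)
  case (less i)
  show ?case
  proof (cases "i = 0")
    case False
    have "of_nat i * opexp A i f = of_nat i * e i"
      unfolding e opexp_recursion[OF assms(1-3)]
      by (intro sum.cong) (auto simp: less.IH)
    then show ?thesis
      using False mps_of_nat_cancel by blast
  qed (simp add: opexp_0 e0)
qed

section \<open>Translation of the generating series by the annihilation part\<close>

definition ann :: "complex \<Rightarrow> nat \<Rightarrow> mps \<Rightarrow> mps" where
  "ann \<sigma> l f = mps_const (\<sigma> / of_nat l) * dd l f"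

lemma ann_0 [simp]: "ann \<sigma> l 0 = 0"
  by (simp add: ann_def derivation_0[OF derivation_dd])

lemma of_nat_ann: "l \<ge> 1 \<Longrightarrow> of_nat l * ann \<sigma> l f = mps_const \<sigma> * dd l f"
  unfolding ann_def mult.assoc[symmetric] mps_const_of_nat[symmetric] mps_const_mult[symmetric]
  by simp

lemma opexp_ann_unique:
  assumes "e 0 = f" and e: "\<And>i. of_nat i * e i = mps_const \<sigma> * (\<Sum>l=1..i. dd l (e (i - l)))"
  shows "opexp (ann \<sigma>) i f = e i"
proof (rule opexp_unique)
  show "ann \<sigma> l (f + g) = ann \<sigma> l f + ann \<sigma> l g" for l f g
    by (simp add: ann_def derivation_add[OF derivation_dd] distrib_left)
  show "ann \<sigma> l (mps_const c * f) = mps_const c * ann \<sigma> l f" for l c f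
    by (simp add: ann_def derivation_const_mult[OF derivation_dd] mult.left_commute)
  show "ann \<sigma> l (ann \<sigma> k f) = ann \<sigma> k (ann \<sigma> l f)" for l k f
    by (simp add: ann_def derivation_const_mult[OF derivation_dd] dd_commute[of l k] mult.left_commute)
  show "of_nat i * e i = (\<Sum>l=1..i. of_nat l * ann \<sigma> l (e (i - l)))" for i
    by (simp add: e of_nat_ann sum_distrib_left)
qed (fact assms(1))

lemma fps_of_nat_mult_nth: "fps_nth (of_nat n * (f :: mps fps)) k = of_nat n * fps_nth f k"
  unfolding fps_of_nat[symmetric] by simp

text \<open>As \<open>dd\<close> kills both \<open>c\<close> and \<open>P\<close>, it acts on H
  alone and multiplies it by the derivative of the exponent. Nothing here mixes powers of s except
  multiplication, so one coefficient k may be fixed throughout.\<close>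

lemma opexp_ann_vector:
  fixes c :: "mps fps" and P :: "nat \<Rightarrow> mps fps"
  assumes c: "\<And>l. l \<ge> 1 \<Longrightarrow> fps_map (dd l) c = 0"
    and P: "\<And>l i. l \<ge> 1 \<Longrightarrow> fps_map (dd l) (P i) = 0"
    and P0: "P 0 = 1"
    and rec: "\<And>i. of_nat i * P i = fps_const (mps_const \<sigma>) * (\<Sum>l=1..i. fps_map (dd l) (Abs_fps Lam) * P (i - l))"
  shows "opexp (ann \<sigma>) i (fps_nth (c * H) k) = fps_nth (c * P i * H) k"
proof (rule opexp_ann_unique)
  fix i
  have dd: "dd l (fps_nth (c * P j * H) k) = fps_nth (fps_map (dd l) (Abs_fps Lam) * P j * (c * H)) k" if "l \<ge> 1" for l j
    unfolding fps_map_nth[symmetric]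
    by (simp add: fps_map_mult[OF derivation_dd] c[OF that] P[OF that] dd_H[OF that] ac_simps)
  have "of_nat i * fps_nth (c * P i * H) k = fps_nth ((of_nat i * P i) * (c * H)) k"
    unfolding fps_of_nat_mult_nth[symmetric] by (simp only: ac_simps)
  also have "\<dots> = mps_const \<sigma> * (\<Sum>l=1..i. fps_nth (fps_map (dd l) (Abs_fps Lam) * P (i - l) * (c * H)) k)"
    unfolding rec by (simp only: mult.assoc sum_distrib_right fps_sum_nth fps_mult_left_const_nth)
  also have "\<dots> = mps_const \<sigma> * (\<Sum>l=1..i. dd l (fps_nth (c * P (i - l) * H) k))"
    by (intro arg_cong2[where f = "(*)"] sum.cong refl dd[symmetric]) simp
  finally show "of_nat i * fps_nth (c * P i * H) k = mps_const \<sigma> * (\<Sum>l=1..i. dd l (fps_nth (c * P (i - l) * H) k))" .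
qed (simp add: P0)

lemma dd_pis: "l \<ge> 1 \<Longrightarrow> fps_map (dd l) (pis i) = 0"
  by (rule fps_ext) (simp add: pis_def dd_pim)

lemma dd_pis_inv: "l \<ge> 1 \<Longrightarrow> fps_map (dd l) (pis_inv i) = 0"
  using dd_pim[of l 1 i] unfolding pis_inv_def pim_def
  by (auto intro!: fps_ext simp: derivation_diff[OF derivation_dd] derivation_0[OF derivation_dd]
      derivation_1[OF derivation_dd] derivation_uminus[OF derivation_dd] fps_X_nth)

lemma opexp_ann_minus_vector:
  assumes "\<And>l. l \<ge> 1 \<Longrightarrow> fps_map (dd l) c = 0"
  shows "opexp (ann (- 1)) i (fps_nth (c * H) k) = fps_nth (c * pis i * H) k"
  by (rule opexp_ann_vector)
    (use assms in \<open>simp_all add: dd_pis pis_0 pis_recursion mps_const_uminus fps_const_neg[symmetric] del: fps_const_neg\<close>)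

lemma opexp_ann_plus_vector:
  assumes "\<And>l. l \<ge> 1 \<Longrightarrow> fps_map (dd l) c = 0"
  shows "opexp (ann 1) i (fps_nth (c * H) k) = fps_nth (c * pis_inv i * H) k"
  by (rule opexp_ann_vector)
    (use assms in \<open>simp_all add: dd_pis_inv pis_inv_recursion, simp add: pis_inv_def\<close>)

section \<open>The modes on the Fock space\<close>

lemma infsum_finite_support:
  fixes f :: "'a \<Rightarrow> mps"
  assumes "finite S" "\<And>x. x \<notin> S \<Longrightarrow> f x = 0"
  shows "(\<Sum>\<^sub>\<infinity>x. f x) = sum f S"
proof -
  have "(\<Sum>\<^sub>\<infinity>x. f x) = infsum f S"
    using assms(2) by (intro infsum_cong_neutral) auto
  then show ?thesis
    using assms(1) by simp
qed

text \<open>The sign treats creation, which has positive powers of z only, and annihilation, which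
  has negative ones only, together. All factors point the same way, so only finitely many exponents
  contribute.\<close>

lemma opser_power_eq:
  fixes \<sigma> :: int
  assumes \<sigma>: "\<sigma> = 1 \<or> \<sigma> = - 1"
    and B: "\<And>k f n. B k f n = (if \<sigma> * k > 0 then A (nat (\<sigma> * k)) (f n) else 0)"
    and zero: "\<And>l. A l 0 = 0"
  shows "((\<lambda>X. B \<odot> X) ^^ m) opser_one k f n = (if \<sigma> * k \<ge> 0 then oppow A m (nat (\<sigma> * k)) (f n) else 0)"
proof (induction m arbitrary: k)
  case 0
  show ?case
    using \<sigma> by (auto simp: opser_one_def)
next
  case (Suc m)
  let ?X = "((\<lambda>X. B \<odot> X) ^^ m) opser_one"
  have inj: "inj_on (\<lambda>l. \<sigma> * int l) S" for S
    using \<sigma> by (auto simp: inj_on_def)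
  have ss: "\<sigma> * (\<sigma> * x) = x" for x
    using \<sigma> by auto
  have "((\<lambda>X. B \<odot> X) ^^ Suc m) opser_one k f n = (\<Sum>\<^sub>\<infinity>k'. B k' (?X (k - k') f) n)"
    by (simp add: opser_mult_def)
  also have "\<dots> = (\<Sum>k'\<in>(\<lambda>l. \<sigma> * int l) ` {1..nat (\<sigma> * k)}. B k' (?X (k - k') f) n)"
  proof (rule infsum_finite_support)
    fix k' assume k': "k' \<notin> (\<lambda>l. \<sigma> * int l) ` {1..nat (\<sigma> * k)}"
    have "\<not> (\<sigma> * k' > 0 \<and> \<sigma> * (k - k') \<ge> 0)"
    proof
      assume *: "\<sigma> * k' > 0 \<and> \<sigma> * (k - k') \<ge> 0"
      then have "k' = \<sigma> * int (nat (\<sigma> * k'))" "nat (\<sigma> * k') \<in> {1..nat (\<sigma> * k)}"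
        by (auto simp: ss right_diff_distrib)
      with k' show False
        by blast
    qed
    then show "B k' (?X (k - k') f) n = 0"
      by (auto simp: B Suc zero)
  qed simp
  also have "\<dots> = (\<Sum>l=1..nat (\<sigma> * k). B (\<sigma> * int l) (?X (k - \<sigma> * int l) f) n)"
    by (simp add: sum.reindex[OF inj])
  also have "\<dots> = (\<Sum>l=1..nat (\<sigma> * k). A l (oppow A m (nat (\<sigma> * k) - l) (f n)))"
    by (rule sum.cong) (auto simp: B Suc ss right_diff_distrib nat_diff_distrib)
  finally show ?case
    by simp
qed

lemma opser_exp_eq:
  fixes \<sigma> :: int
  assumes \<sigma>: "\<sigma> = 1 \<or> \<sigma> = - 1"
    and B: "\<And>k f n. B k f n = (if \<sigma> * k > 0 then A (nat (\<sigma> * k)) (f n) else 0)"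
    and zero: "\<And>l. A l 0 = 0"
  shows "opser_exp B k f n = (if \<sigma> * k \<ge> 0 then opexp A (nat (\<sigma> * k)) (f n) else 0)"
proof -
  have "opser_exp B k f n = (\<Sum>m\<le>nat (\<sigma> * k). mps_const (1 / fact m) *
      (if \<sigma> * k \<ge> 0 then oppow A m (nat (\<sigma> * k)) (f n) else 0))"
    unfolding opser_exp_def opser_power_eq[of \<sigma> B A, OF assms]
    by (rule suminf_finite) (auto simp: oppow_eq_0[of A, OF zero])
  then show ?thesis
    by (auto simp: opexp_def)
qed

lemma opser_exp_creation: "opser_exp creation k f n = SS k * f n"
proof -
  have "opser_exp creation k f n = (if 1 * k \<ge> 0 then opexp (\<lambda>l g. uv l * g) (nat (1 * k)) (f n) else 0)"
    by (rule opser_exp_eq) (auto simp: creation_def fmult_def uv_def)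
  then show ?thesis
    by (simp add: opexp_mult SS_def)
qed

lemma opser_exp_uminus_creation: "opser_exp (opser_uminus creation) k f n = SM k * f n"
proof -
  have "opser_exp (opser_uminus creation) k f n
      = (if 1 * k \<ge> 0 then opexp (\<lambda>l g. - uv l * g) (nat (1 * k)) (f n) else 0)"
    by (rule opser_exp_eq) (auto simp: opser_uminus_def creation_def fmult_def uv_def algebra_simps)
  then show ?thesis
    by (simp only: opexp_mult[of "\<lambda>l. - uv l"] mult_1) (simp add: SM_def)
qed

lemma opser_exp_annihilation:
  "opser_exp annihilation k f n = (if k \<le> 0 then opexp (ann 1) (nat (- k)) (f n) else 0)"
proof -
  have "opser_exp annihilation k f n = (if - 1 * k \<ge> 0 then opexp (ann 1) (nat (- 1 * k)) (f n) else 0)"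
  proof (rule opser_exp_eq)
    show "annihilation k f n = (if - 1 * k > 0 then ann 1 (nat (- 1 * k)) (f n) else 0)" for k f n
      by (auto simp: annihilation_def ann_def dd_def)
  qed auto
  then show ?thesis
    by simp
qed

lemma opser_exp_uminus_annihilation:
  "opser_exp (opser_uminus annihilation) k f n = (if k \<le> 0 then opexp (ann (- 1)) (nat (- k)) (f n) else 0)"
proof -
  have "opser_exp (opser_uminus annihilation) k f n
      = (if - 1 * k \<ge> 0 then opexp (ann (- 1)) (nat (- 1 * k)) (f n) else 0)"
  proof (rule opser_exp_eq)
    fix k f n
    show "opser_uminus annihilation k f n = (if - 1 * k > 0 then ann (- 1) (nat (- 1 * k)) (f n) else 0)"
      by (auto simp: opser_uminus_def annihilation_def ann_def dd_def mps_const_uminus)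
  qed auto
  then show ?thesis
    by simp
qed

text \<open>This mode is the coefficient of z^(j-1), and the factor 1/p moves the charge from n + 1
  to n.\<close>

lemma phi_eq:
  assumes "\<And>i. i > K \<Longrightarrow> opexp (ann 1) i (f (n + 1)) = 0"
  shows "phi (- int j) f n = (\<Sum>i\<le>K. SM (int j - 1 + int i) * opexp (ann 1) i (f (n + 1)))"
proof -
  have "phi (- int j) f n = (\<Sum>\<^sub>\<infinity>k. SM k * opser_exp annihilation (int j - 1 - k) f (n + 1))"
    by (simp add: phi_def phi_series_def pshift_def opser_mult_def opser_exp_uminus_creation)
  also have "\<dots> = (\<Sum>k\<in>(\<lambda>i. int j - 1 + int i) ` {..K}. SM k * opser_exp annihilation (int j - 1 - k) f (n + 1))"
  proof (rule infsum_finite_support)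
    fix k assume k: "k \<notin> (\<lambda>i. int j - 1 + int i) ` {..K}"
    show "SM k * opser_exp annihilation (int j - 1 - k) f (n + 1) = 0"
    proof (cases "int j - 1 - k \<le> 0")
      case True
      then have "k = int j - 1 + int (nat (- (int j - 1 - k)))"
        by simp
      with k have "nat (- (int j - 1 - k)) > K"
        by (metis atMost_iff image_eqI not_le)
      then show ?thesis
        by (simp add: opser_exp_annihilation assms)
    qed (simp add: opser_exp_annihilation)
  qed simp
  also have "\<dots> = (\<Sum>i\<le>K. SM (int j - 1 + int i) * opexp (ann 1) i (f (n + 1)))"
    by (subst sum.reindex) (auto simp: inj_on_def opser_exp_annihilation)
  finally show ?thesis .
qed

text \<open>The coefficient of $z^b$ in the current, acting on vectors of charge 0.\<close>

definition cur :: "int \<Rightarrow> mps \<Rightarrow> mps" where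
  "cur b g = (if b \<ge> 0 then of_int (b + 1) * xv (nat (b + 1)) * g
     else if b = - 1 then 0 else dx (nat (- b - 1)) g)"

lemma cur_0 [simp]: "cur b 0 = 0"
  by (simp add: cur_def derivation_0[OF derivation_dx])

lemma current_eq: "n = 0 \<or> g n = 0 \<Longrightarrow> current b g n = cur b (g n)"
  by (auto simp: current_def cur_def)

text \<open>This mode is the coefficient of z^1. The hypothesis \<open>charge\<close> makes p d/dp
  contribute 0. For a > 2 K + 2 the exponent 1 - a + i is at most - K - 2, where the current is a
  derivative of index above K; this explains the range of a.\<close>

lemma phi_star_eq:
  assumes charge: "n = 1 \<or> f (n - 1) = 0"
    and K: "\<And>i. i > K \<Longrightarrow> opexp (ann (- 1)) i (f (n - 1)) = 0"
    and dx: "\<And>i m. m > K \<Longrightarrow> dx m (opexp (ann (- 1)) i (f (n - 1))) = 0"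
  shows "phi_star (- 1) f n
    = (\<Sum>a\<le>2 * K + 2. \<Sum>i\<le>K. SS (int a) * cur (1 - int a + int i) (opexp (ann (- 1)) i (f (n - 1))))"
proof -
  let ?e = "\<lambda>i. opexp (ann (- 1)) i (f (n - 1))" and ?E = "opser_exp (opser_uminus annihilation)"
  have inner: "(current \<odot> ?E) k f (n - 1) = (\<Sum>i\<le>K. cur (k + int i) (?e i))" for k
  proof -
    have cur: "current b (?E c f) (n - 1) = cur b (if c \<le> 0 then ?e (nat (- c)) else 0)" for b c
      using charge
      by (subst current_eq) (auto simp: opser_exp_uminus_annihilation opexp_0_right)
    have "(current \<odot> ?E) k f (n - 1) = (\<Sum>\<^sub>\<infinity>b. cur b (if k - b \<le> 0 then ?e (nat (- (k - b))) else 0))"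
      by (simp add: opser_mult_def cur)
    also have "\<dots> = (\<Sum>b\<in>(\<lambda>i. k + int i) ` {..K}. cur b (if k - b \<le> 0 then ?e (nat (- (k - b))) else 0))"
    proof (rule infsum_finite_support)
      fix b assume b: "b \<notin> (\<lambda>i. k + int i) ` {..K}"
      show "cur b (if k - b \<le> 0 then ?e (nat (- (k - b))) else 0) = 0"
      proof (cases "k - b \<le> 0")
        case True
        then have "b = k + int (nat (- (k - b)))"
          by simp
        with b have "nat (- (k - b)) > K"
          by (metis atMost_iff image_eqI not_le)
        then show ?thesis
          by (simp add: K)
      qed simp
    qed simp
    also have "\<dots> = (\<Sum>i\<le>K. cur (k + int i) (?e i))"
      by (subst sum.reindex) (auto simp: inj_on_def)
    finally show ?thesis .
  qed
  have "phi_star (- 1) f n = (\<Sum>\<^sub>\<infinity>a. SS a * (\<Sum>i\<le>K. cur (1 - a + int i) (?e i)))"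
    by (simp add: phi_star_def phi_star_series_def pshift_def opser_mult_def[of "opser_exp creation"]
        opser_exp_creation inner)
  also have "\<dots> = (\<Sum>a\<in>int ` {..2 * K + 2}. SS a * (\<Sum>i\<le>K. cur (1 - a + int i) (?e i)))"
  proof (rule infsum_finite_support)
    fix a assume a: "a \<notin> int ` {..2 * K + 2}"
    show "SS a * (\<Sum>i\<le>K. cur (1 - a + int i) (?e i)) = 0"
    proof (cases "a < 0")
      case False
      then have "a > int (2 * K + 2)"
        using a by (metis atMost_iff image_eqI int_nat_eq not_le nat_le_iff of_nat_le_iff)
      then have "cur (1 - a + int i) (?e i) = 0" if "i \<le> K" for i
        using that by (auto simp: cur_def intro!: dx)
      then show ?thesis
        by simp
    qed simp
  qed simp
  also have "\<dots> = (\<Sum>a\<le>2 * K + 2. \<Sum>i\<le>K. SS (int a) * cur (1 - int a + int i) (?e i))"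
    by (subst sum.reindex) (auto simp: inj_on_def sum_distrib_left)
  finally show ?thesis .
qed

section \<open>The orbit of the vacuum\<close>

definition A0 :: "nat \<Rightarrow> mps" where
  "A0 j = SM (int j - 1)"

definition B0 :: "nat \<Rightarrow> mps" where
  "B0 j = u1 * SM (int j) + SM (int j + 1)"

definition beta :: "nat \<Rightarrow> mps fps" where
  "beta j = fps_const (A0 j) + fps_const (B0 j) * fps_X"

definition YF :: "int \<Rightarrow> mps fps" where
  "YF c = Abs_fps (\<lambda>r. Y r c)"

text \<open>Differentiating S_c(-u) in x_m lowers c by m. At s^0 the sum is therefore the tail of
  \<open>SS_SM_convolution\<close> at index j + 1, and its first three terms form the right-hand
  side. At higher powers \<open>Y_Suc\<close> lowers r and the shifted sums cancel; the bound on
  \<open>M\<close> makes their upper boundary terms vanish.\<close>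

lemma beta_identity:
  assumes j: "j \<ge> 1" and M: "M \<ge> j + 1"
  shows "(\<Sum>m=1..M. YF (int m + 2) * fps_map (dx m) (beta j)) = fps_const (B0 j) + fps_const (A0 j) * YF 2"
proof (rule fps_ext)
  fix r
  have dxA: "dx m (A0 j) = - SM (int j - 1 - int m)" if "m \<ge> 1" for m
    using that by (simp add: A0_def dx_SM)
  have dxB: "dx m (B0 j) = (if m = 1 then SM (int j) else 0) - u1 * SM (int j - int m) - SM (int j + 1 - int m)"
    if "m \<ge> 1" for m
    using that by (simp add: B0_def dx_SM dx_u1 derivation_add[OF derivation_dx] derivation_mult[OF derivation_dx])
  have map: "fps_map (dx m) (beta j) = fps_const (dx m (A0 j)) + fps_const (dx m (B0 j)) * fps_X" for m
    unfolding beta_def fps_map_add[OF derivation_dx] fps_map_mult[OF derivation_dx] fps_map_fps_const[OF derivation_dx]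
      fps_map_X[OF derivation_dx] by simp
  have nth: "fps_nth (YF c * (fps_const \<alpha> + fps_const \<gamma> * fps_X)) r
      = Y r c * \<alpha> + (if r = 0 then 0 else Y (r - 1) c * \<gamma>)" for c \<alpha> \<gamma>
  proof -
    have "YF c * (fps_const \<alpha> + fps_const \<gamma> * fps_X) = fps_const \<alpha> * YF c + fps_const \<gamma> * (fps_X * YF c)"
      by (simp only: distrib_left ac_simps)
    then show ?thesis
      by (simp add: YF_def mult.commute)
  qed
  have lhs: "fps_nth (\<Sum>m=1..M. YF (int m + 2) * fps_map (dx m) (beta j)) r
      = (\<Sum>m=1..M. Y r (int m + 2) * dx m (A0 j)) + (\<Sum>m=1..M. if r = 0 then 0 else Y (r - 1) (int m + 2) * dx m (B0 j))"
    by (simp only: fps_sum_nth map nth sum.distrib)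
  have dxA_sum: "(\<Sum>m=1..M. F m * dx m (A0 j)) = - (\<Sum>m=1..M. F m * SM (int j - 1 - int m))" for F :: "nat \<Rightarrow> mps"
    unfolding sum_negf[symmetric] by (rule sum.cong) (auto simp: dxA)
  show "fps_nth (\<Sum>m=1..M. YF (int m + 2) * fps_map (dx m) (beta j)) r
      = fps_nth (fps_const (B0 j) + fps_const (A0 j) * YF 2) r"
  proof (cases r)
    case 0
    have "(\<Sum>i=0..nat (int j + 1) + M. SS (int i) * SM (int j + 1 - int i)) = 0"
      by (rule SS_SM_convolution) simp
    moreover have "(\<Sum>i=0..nat (int j + 1) + M. SS (int i) * SM (int j + 1 - int i))
        = (\<Sum>i=0..M+2. SS (int i) * SM (int j + 1 - int i))"
      using M j by (intro sum.mono_neutral_right) auto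
    moreover have "(\<Sum>i=0..M+2. SS (int i) * SM (int j + 1 - int i))
        = SM (int j + 1) + u1 * SM (int j) + SS 2 * SM (int j - 1) + (\<Sum>m=1..M. SS (int m + 2) * SM (int j - 1 - int m))"
    proof -
      have "(\<Sum>i=0..M+2. SS (int i) * SM (int j + 1 - int i))
        = SM (int j + 1) + u1 * SM (int j) + (\<Sum>m=0..M. SS (int m + 2) * SM (int j - 1 - int m))"
        by (simp add: sum.atLeast0_atMost_Suc_shift[of _ "Suc M"] sum.atLeast0_atMost_Suc_shift[of _ M] add.assoc
            del: sum.atLeast0_atMost_Suc sum.cl_ivl_Suc) (simp add: algebra_simps)
      also have "(\<Sum>m=0..M. SS (int m + 2) * SM (int j - 1 - int m))
          = SS 2 * SM (int j - 1) + (\<Sum>m=1..M. SS (int m + 2) * SM (int j - 1 - int m))"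
        by (simp add: sum.atLeast_Suc_atMost)
      finally show ?thesis
        by (simp add: add.assoc)
    qed
    ultimately have "- (\<Sum>m=1..M. SS (int m + 2) * SM (int j - 1 - int m)) = B0 j + A0 j * SS 2"
      by (simp add: A0_def B0_def neg_eq_iff_add_eq_0 ac_simps)
    with 0 show ?thesis
      unfolding lhs dxA_sum by (simp add: Y_0 YF_def)
  next
    case (Suc r')
    define f1 where "f1 m = Y r' (int m + 2) * SM (int j - int m)" for m
    define f2 where "f2 m = Y r' (int m + 2) * SM (int j + 1 - int m)" for m
    have "- (\<Sum>m=1..M. Y r (int m + 2) * SM (int j - 1 - int m))
        = u1 * (\<Sum>m=1..M. f1 (Suc m)) + (\<Sum>m=1..M. f2 (Suc (Suc m)))"
      unfolding sum_negf[symmetric] sum_distrib_left sum.distrib[symmetric]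
      by (rule sum.cong) (simp_all add: Suc Y_Suc f1_def f2_def algebra_simps)
    also have "(\<Sum>m=1..M. f1 (Suc m)) = (\<Sum>m=1..M. f1 m) - Y r' 3 * SM (int j - 1)"
      using M by (simp only: sum_shift_1[of f1]) (simp add: f1_def)
    also have "(\<Sum>m=1..M. f2 (Suc (Suc m))) = (\<Sum>m=1..M. f2 m) - Y r' 3 * SM (int j) - Y r' 4 * SM (int j - 1)"
      using M by (simp only: sum_shift_1[of "\<lambda>m. f2 (Suc m)"] sum_shift_1[of f2]) (simp add: f2_def)
    finally have 1: "- (\<Sum>m=1..M. Y r (int m + 2) * SM (int j - 1 - int m))
        = u1 * ((\<Sum>m=1..M. f1 m) - Y r' 3 * SM (int j - 1)) +
          ((\<Sum>m=1..M. f2 m) - Y r' 3 * SM (int j) - Y r' 4 * SM (int j - 1))" .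
    have "(\<Sum>m=1..M. Y r' (int m + 2) * dx m (B0 j))
        = (\<Sum>m=1..M. (if m = 1 then Y r' 3 * SM (int j) else 0) - u1 * f1 m - f2 m)"
      by (rule sum.cong) (auto simp: dxB f1_def f2_def algebra_simps)
    also have "\<dots> = Y r' 3 * SM (int j) - u1 * (\<Sum>m=1..M. f1 m) - (\<Sum>m=1..M. f2 m)"
      using M by (simp add: sum_subtractf sum_distrib_left)
    finally have 2: "(\<Sum>m=1..M. Y r' (int m + 2) * dx m (B0 j))
        = Y r' 3 * SM (int j) - u1 * (\<Sum>m=1..M. f1 m) - (\<Sum>m=1..M. f2 m)" .
    have "fps_nth (\<Sum>m=1..M. YF (int m + 2) * fps_map (dx m) (beta j)) r
        = - (\<Sum>m=1..M. Y r (int m + 2) * SM (int j - 1 - int m)) + (\<Sum>m=1..M. Y r' (int m + 2) * dx m (B0 j))"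
      unfolding lhs dxA_sum by (simp add: Suc)
    also have "\<dots> = A0 j * Y r 2"
      unfolding 1 2 by (simp add: Suc Y_Suc A0_def algebra_simps)
    finally show ?thesis
      by (simp add: Suc YF_def)
  qed
qed

lemma dd_beta: "l \<ge> 1 \<Longrightarrow> fps_map (dd l) (beta j) = 0"
  unfolding beta_def fps_map_add[OF derivation_dd] fps_map_mult[OF derivation_dd] fps_map_fps_const[OF derivation_dd]
    fps_map_X[OF derivation_dd]
  by (simp add: A0_def B0_def derivation_add[OF derivation_dd] derivation_mult[OF derivation_dd] dd_u1 dd_SM)

lemma dd_beta_power: "l \<ge> 1 \<Longrightarrow> fps_map (dd l) (beta j ^ k) = 0"
  by (simp add: fps_map_power[OF derivation_dd] dd_beta)

section \<open>The current on the generating series\<close>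

text \<open>The creation exponent a leaves 1 - a + i for the current: a <= i + 1 multiplies by m x_m
  with m = i + 2 - a, a = i + 2 hits the charge term, which is 0, and a >= i + 3 differentiates with
  m = a - i - 2.\<close>

lemma sum_cur:
  assumes dx: "\<And>m. m > K \<Longrightarrow> dx m e = 0" and i: "i \<le> K"
  shows "(\<Sum>a\<le>2 * K + 2. SS (int a) * cur (1 - int a + int i) e)
    = (\<Sum>m=1..K+2. of_nat m * xv m * (SS (2 - int m + int i) * e) + SS (int m + 2 + int i) * dx m e)"
proof -
  let ?f = "\<lambda>a. SS (int a) * cur (1 - int a + int i) e"
  have "(\<Sum>a\<le>2 * K + 2. ?f a) = (\<Sum>a\<in>{..i + 1} \<union> {i + 2 + 1..i + 2 + (2 * K - i)}. ?f a)"
  proof (rule sum.mono_neutral_right)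
    show "\<forall>a\<in>{..2 * K + 2} - ({..i + 1} \<union> {i + 2 + 1..i + 2 + (2 * K - i)}). ?f a = 0"
    proof
      fix a assume "a \<in> {..2 * K + 2} - ({..i + 1} \<union> {i + 2 + 1..i + 2 + (2 * K - i)})"
      with i have "a = i + 2"
        by auto
      then show "?f a = 0"
        by (simp add: cur_def)
    qed
  qed (use i in auto)
  also have "\<dots> = (\<Sum>a\<le>i + 1. ?f a) + (\<Sum>a=i + 2 + 1..i + 2 + (2 * K - i). ?f a)"
    by (rule sum.union_disjoint) auto
  also have "(\<Sum>a\<le>i + 1. ?f a) = (\<Sum>m=1..i+2. of_nat m * xv m * (SS (2 - int m + int i) * e))"
    by (rule sum.reindex_bij_witness[where i = "\<lambda>m. i + 2 - m" and j = "\<lambda>a. i + 2 - a"])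
      (auto simp: cur_def of_nat_diff nat_diff_distrib algebra_simps nat_add_distrib)
  also have "\<dots> = (\<Sum>m=1..K+2. of_nat m * xv m * (SS (2 - int m + int i) * e))"
    using i by (intro sum.mono_neutral_left) auto
  also have "(\<Sum>a=i + 2 + 1..i + 2 + (2 * K - i). ?f a) = (\<Sum>m=1..2 * K - i. SS (int m + 2 + int i) * dx m e)"
    by (rule sum.reindex_bij_witness[where i = "\<lambda>m. i + 2 + m" and j = "\<lambda>a. a - (i + 2)"])
      (auto simp: cur_def of_nat_diff nat_diff_distrib algebra_simps nat_add_distrib)
  also have "\<dots> = (\<Sum>m=1..K. SS (int m + 2 + int i) * dx m e)"
    using i by (intro sum.mono_neutral_right) (auto simp: dx)
  also have "\<dots> = (\<Sum>m=1..K+2. SS (int m + 2 + int i) * dx m e)"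
    by (intro sum.mono_neutral_left) (auto simp: dx)
  finally show ?thesis
    by (simp add: sum.distrib)
qed

lemma sum_SS_pis:
  assumes "2 * k \<le> K"
  shows "(\<Sum>i\<le>K. SS (c + int i) * fps_nth (F * pis i) k) = fps_nth (F * YF c) k"
proof -
  have "(\<Sum>i\<le>K. SS (c + int i) * fps_nth (F * pis i) k)
      = (\<Sum>r=0..k. fps_nth F r * (\<Sum>i\<le>K. SS (c + int i) * pim (k - r) i))"
    by (simp add: fps_mult_nth pis_def sum_distrib_left sum.swap[of _ "{..K}"] mult.left_commute)
  also have "\<dots> = (\<Sum>r=0..k. fps_nth F r * Y (k - r) c)"
    using assms by (intro sum.cong refl) (simp add: Y_eq[where K = K] pr_def pim_def)
  finally show ?thesis
    by (simp add: fps_mult_nth YF_def)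
qed

text \<open>The effect of the derivative in x_1 on the translation factor: the u_1-derivative of 1 /
  (1 - s Q) is - s v / (1 - s Q)^2, with s^r-coefficient - r v Q^(r-1). The extra v turns the index
  3 into 4.\<close>

definition ZF :: "mps fps" where
  "ZF = Abs_fps (\<lambda>r. - (of_nat r * Y (r - 1) 4))"

lemma sum_SS_dx_pis:
  assumes "2 * k + 1 \<le> K"
  shows "(\<Sum>i\<le>K. SS (3 + int i) * fps_nth (F * fps_map (dx 1) (pis i)) k) = fps_nth (F * ZF) k"
proof -
  obtain K' where K': "K = Suc K'"
    using assms by (cases K) auto
  have pim: "dx 1 (pim r i) = - (of_nat r * (if i = 0 then 0 else pim (r - 1) (i - 1)))" for r i
    by (simp add: derivation_pim[OF derivation_dx] dx_u1)
  have "(\<Sum>i\<le>K. SS (3 + int i) * dx 1 (pim r i)) = - (of_nat r * Y (r - 1) 4)" if "r \<le> k" for r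
  proof -
    have "(\<Sum>i\<le>K. SS (3 + int i) * dx 1 (pim r i)) = - (of_nat r * (\<Sum>i\<le>K'. SS (4 + int i) * pim (r - 1) i))"
      unfolding K' pim by (subst sum.atMost_Suc_shift) (simp add: sum_distrib_left sum_negf mult.left_commute)
    also have "(\<Sum>i\<le>K'. SS (4 + int i) * pim (r - 1) i) = Y (r - 1) 4"
      using assms that K' by (subst Y_eq[where K = K']) (auto simp: pr_def pim_def)
    finally show ?thesis .
  qed
  moreover have "(\<Sum>i\<le>K. SS (3 + int i) * fps_nth (F * fps_map (dx 1) (pis i)) k)
      = (\<Sum>r=0..k. fps_nth F r * (\<Sum>i\<le>K. SS (3 + int i) * dx 1 (pim (k - r) i)))"
    by (simp add: fps_mult_nth pis_def sum_distrib_left sum.swap[of _ "{..K}"] mult.left_commute)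
  ultimately show ?thesis
    by (simp add: fps_mult_nth ZF_def)
qed

lemma Lam_fps_identity:
  assumes M: "2 * k + 2 \<le> M" and N: "N \<le> k"
  shows "fps_nth ((\<Sum>m=1..M. fps_const (of_nat m * xv m) * YF (2 - int m)) + ZF
        + (\<Sum>m=1..M. YF (int m + 2) * fps_map (dx m) (Abs_fps Lam))) N
    = fps_nth (fps_deriv (Abs_fps Lam) - fps_X * fps_deriv (YF 2) - fps_X * (YF 2 * fps_deriv (Abs_fps Lam))) N"
proof -
  have conv: "fps_nth (YF c * Abs_fps g) N = (\<Sum>n<N. Y (N - Suc n) c * g (Suc n))" if "g 0 = 0" for c g
  proof -
    have "fps_nth (YF c * Abs_fps g) N = fps_nth (Abs_fps g * YF c) N"
      by (simp add: mult.commute)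
    also have "\<dots> = (\<Sum>n\<le>N. g n * Y (N - n) c)"
      by (simp add: fps_mult_nth YF_def atMost_atLeast0)
    also have "\<dots> = (\<Sum>n<N. Y (N - Suc n) c * g (Suc n))"
      by (cases N) (simp_all add: that sum.atMost_Suc_shift lessThan_Suc_atMost mult.commute del: sum.atMost_Suc)
    finally show ?thesis .
  qed
  have 1: "fps_nth (fps_X * (YF 2 * fps_deriv (Abs_fps Lam))) N
      = (\<Sum>n<N. Y (N - Suc n) 2 * (of_nat (Suc n) * Lam (Suc n)))"
  proof -
    have "fps_X * (YF 2 * fps_deriv (Abs_fps Lam)) = YF 2 * (fps_X * fps_deriv (Abs_fps Lam))"
      by (simp only: ac_simps)
    also have "fps_X * fps_deriv (Abs_fps Lam) = Abs_fps (\<lambda>n. of_nat n * Lam n)"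
      by (rule fps_ext) (simp del: of_nat_Suc)
    finally show ?thesis
      using conv[of "\<lambda>n. of_nat n * Lam n"] by simp
  qed
  have 2: "fps_nth (YF c * fps_map (dx m) (Abs_fps Lam)) N = (\<Sum>n<N. Y (N - Suc n) c * dx m (Lam (Suc n)))" for c m
    using conv[of "\<lambda>n. dx m (Lam n)"] by (simp add: fps_map_def derivation_0[OF derivation_dx])
  have 3: "fps_nth (fps_X * fps_deriv (YF 2)) N = of_nat N * Y N 2"
    by (cases N) (simp_all add: YF_def del: of_nat_Suc)
  have M': "2 * N + 2 \<le> M"
    using M N by simp
  have "fps_nth ((\<Sum>m=1..M. fps_const (of_nat m * xv m) * YF (2 - int m)) + ZF
        + (\<Sum>m=1..M. YF (int m + 2) * fps_map (dx m) (Abs_fps Lam))) N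
      = (\<Sum>m=1..M. of_nat m * xv m * Y N (2 - int m)) - of_nat N * Y (N - 1) 4
        + (\<Sum>m=1..M. \<Sum>n<N. Y (N - Suc n) (int m + 2) * dx m (Lam (Suc n)))"
    by (simp only: fps_add_nth fps_sum_nth 2 fps_mult_left_const_nth) (simp add: YF_def ZF_def)
  also have "\<dots> = of_nat (Suc N) * Lam (Suc N) - of_nat N * Y N 2
      - (\<Sum>n<N. Y (N - Suc n) 2 * (of_nat (Suc n) * Lam (Suc n)))"
    unfolding Lam_identity[OF M', symmetric] by simp
  also have "\<dots> = fps_nth (fps_deriv (Abs_fps Lam) - fps_X * fps_deriv (YF 2) - fps_X * (YF 2 * fps_deriv (Abs_fps Lam))) N"
    by (simp only: fps_sub_nth 1 3) simp
  finally show ?thesis .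
qed

lemma fps_mult_nth_cong:
  fixes F G G' :: "mps fps"
  assumes "\<And>N. N \<le> k \<Longrightarrow> fps_nth G N = fps_nth G' N"
  shows "fps_nth (F * G) k = fps_nth (F * G') k"
  using assms by (simp add: fps_mult_nth)

lemma deriv_H: "fps_deriv H = fps_deriv (Abs_fps Lam) * H"
  using expS_deriv[of Lam] by (simp add: H_def)

lemma dx_H: "fps_map (dx m) H = fps_map (dx m) (Abs_fps Lam) * H"
  using fps_map_expS[OF derivation_dx, of m Lam] by (simp add: H_def)

lemma dx_beta_eq_0:
  assumes "m > j + 1"
  shows "fps_map (dx m) (beta j) = 0"
  unfolding beta_def fps_map_add[OF derivation_dx] fps_map_mult[OF derivation_dx] fps_map_fps_const[OF derivation_dx]
    fps_map_X[OF derivation_dx]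
  using assms by (simp add: A0_def B0_def derivation_add[OF derivation_dx] derivation_mult[OF derivation_dx] dx_u1 dx_SM)

lemma dx_pis_eq_0: "m \<noteq> 1 \<Longrightarrow> m \<ge> 1 \<Longrightarrow> fps_map (dx m) (pis i) = 0"
  by (rule fps_ext) (simp add: pis_def derivation_pim[OF derivation_dx] dx_u1)

lemma dx_Lam_eq_0:
  assumes "m > 2 * n" "m \<noteq> 1"
  shows "dx m (Lam n) = 0"
proof (cases "n = 0")
  case False
  have "dx m (pim n k * (of_nat k * xv k)) = 0" if "k \<in> {1..2*n}" for k
    using assms that
    by (simp add: derivation_mult[OF derivation_dx] derivation_pim[OF derivation_dx] dx_u1
        derivation_of_nat[OF derivation_dx] dx_xv)
  then show ?thesis
    by (simp add: Lam_def derivation_uminus[OF derivation_dx] derivation_const_mult[OF derivation_dx]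
        derivation_sum[OF derivation_dx] del: derivation_mult)
qed (simp add: derivation_0[OF derivation_dx])

text \<open>Up to s^k, \<open>beta\<close> reaches index j + 1, \<open>Lam\<close> reaches 2 k, and
  \<open>pis\<close> contains only u_1. This supplies the finite bound that
  \<open>phi_star_eq\<close> requires.\<close>

lemma dx_vector_eq_0:
  assumes "m > 2 * k + j + 2"
  shows "dx m (fps_nth (beta j ^ k * H * pis i) k) = 0"
proof -
  have "fps_map (dx m) (beta j ^ k * H * pis i) = (beta j ^ k * H * pis i) * fps_map (dx m) (Abs_fps Lam)"
    using assms by (simp add: fps_map_mult[OF derivation_dx] fps_map_power[OF derivation_dx] dx_beta_eq_0 dx_pis_eq_0 dx_H ac_simps)
  then have "dx m (fps_nth (beta j ^ k * H * pis i) k) = fps_nth ((beta j ^ k * H * pis i) * fps_map (dx m) (Abs_fps Lam)) k"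
    by (simp flip: fps_map_nth)
  also have "\<dots> = fps_nth ((beta j ^ k * H * pis i) * 0) k"
    using assms by (intro fps_mult_nth_cong) (simp add: dx_Lam_eq_0)
  finally show ?thesis
    by simp
qed

text \<open>The current multiplies by x and differentiates beta, H and the translation factor.
  \<open>beta_identity\<close> handles the derivative of beta, \<open>Lam_fps_identity\<close> all
  the rest.\<close>

lemma current_on_vector:
  assumes j: "j \<ge> 1" and K: "K = 2 * k + j + 2"
  shows "(\<Sum>a\<le>2 * K + 2. \<Sum>i\<le>K. SS (int a) * cur (1 - int a + int i) (fps_nth (beta j ^ k * H * pis i) k))
    = of_nat (Suc k) * fps_nth (beta j ^ k * H) (Suc k)"
proof -
  define W where "W = beta j ^ k * H"
  define L where "L = Abs_fps Lam"
  define e where "e i = fps_nth (W * pis i) k" for i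
  let ?M = "K + 2"
  let ?\<Omega> = "(\<Sum>m=1..?M. fps_const (of_nat m * xv m) * YF (2 - int m)) + ZF
        + (\<Sum>m=1..?M. YF (int m + 2) * fps_map (dx m) L)"
  have "(\<Sum>a\<le>2 * K + 2. \<Sum>i\<le>K. SS (int a) * cur (1 - int a + int i) (e i))
      = (\<Sum>i\<le>K. \<Sum>a\<le>2 * K + 2. SS (int a) * cur (1 - int a + int i) (e i))"
    by (rule sum.swap)
  also have "\<dots> = (\<Sum>i\<le>K. \<Sum>m=1..?M. of_nat m * xv m * (SS (2 - int m + int i) * e i) + SS (int m + 2 + int i) * dx m (e i))"
    by (intro sum.cong refl sum_cur) (auto simp: e_def W_def dx_vector_eq_0 K)
  also have "\<dots> = (\<Sum>m=1..?M. of_nat m * xv m * (\<Sum>i\<le>K. SS (2 - int m + int i) * e i))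
      + (\<Sum>m=1..?M. \<Sum>i\<le>K. SS (int m + 2 + int i) * dx m (e i))"
    by (subst sum.swap) (simp add: sum.distrib sum_distrib_left)
  also have "(\<Sum>m=1..?M. of_nat m * xv m * (\<Sum>i\<le>K. SS (2 - int m + int i) * e i))
      = fps_nth (W * (\<Sum>m=1..?M. fps_const (of_nat m * xv m) * YF (2 - int m))) k"
  proof -
    have "(\<Sum>i\<le>K. SS (2 - int m + int i) * e i) = fps_nth (W * YF (2 - int m)) k" for m
      unfolding e_def by (rule sum_SS_pis) (simp add: K)
    then show ?thesis
      by (simp only: sum_distrib_left fps_sum_nth mult.left_commute[of W] fps_mult_left_const_nth)
  qed
  also have "(\<Sum>m=1..?M. \<Sum>i\<le>K. SS (int m + 2 + int i) * dx m (e i))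
      = (\<Sum>m=1..?M. fps_nth (fps_map (dx m) W * YF (int m + 2)) k + (if m = 1 then fps_nth (W * ZF) k else 0))"
  proof (rule sum.cong)
    fix m assume m: "m \<in> {1..?M}"
    have "dx m (e i) = fps_nth (fps_map (dx m) W * pis i) k + fps_nth (W * fps_map (dx m) (pis i)) k" for i
      unfolding e_def fps_map_nth[symmetric] fps_map_mult[OF derivation_dx] by simp
    then have "(\<Sum>i\<le>K. SS (int m + 2 + int i) * dx m (e i))
        = (\<Sum>i\<le>K. SS (int m + 2 + int i) * fps_nth (fps_map (dx m) W * pis i) k)
          + (\<Sum>i\<le>K. SS (int m + 2 + int i) * fps_nth (W * fps_map (dx m) (pis i)) k)"
      by (simp only: distrib_left sum.distrib)
    also have "(\<Sum>i\<le>K. SS (int m + 2 + int i) * fps_nth (fps_map (dx m) W * pis i) k)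
        = fps_nth (fps_map (dx m) W * YF (int m + 2)) k"
      by (rule sum_SS_pis) (simp add: K)
    also have "(\<Sum>i\<le>K. SS (int m + 2 + int i) * fps_nth (W * fps_map (dx m) (pis i)) k)
        = (if m = 1 then fps_nth (W * ZF) k else 0)"
      using sum_SS_dx_pis[of k K W] m by (auto simp: K dx_pis_eq_0)
    finally show "(\<Sum>i\<le>K. SS (int m + 2 + int i) * dx m (e i))
        = fps_nth (fps_map (dx m) W * YF (int m + 2)) k + (if m = 1 then fps_nth (W * ZF) k else 0)" .
  qed simp
  also have "\<dots> = fps_nth (\<Sum>m=1..?M. fps_map (dx m) W * YF (int m + 2)) k + fps_nth (W * ZF) k"
    by (simp add: sum.distrib fps_sum_nth)
  also have "(\<Sum>m=1..?M. fps_map (dx m) W * YF (int m + 2))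
      = of_nat k * beta j ^ (k - 1) * H * (\<Sum>m=1..?M. YF (int m + 2) * fps_map (dx m) (beta j))
        + W * (\<Sum>m=1..?M. YF (int m + 2) * fps_map (dx m) L)"
    unfolding sum_distrib_left sum.distrib[symmetric]
    by (rule sum.cong)
      (simp_all add: W_def L_def fps_map_mult[OF derivation_dx] fps_map_power[OF derivation_dx] dx_H algebra_simps)
  also have "(\<Sum>m=1..?M. YF (int m + 2) * fps_map (dx m) (beta j)) = fps_const (B0 j) + fps_const (A0 j) * YF 2"
    by (rule beta_identity[OF j]) (simp add: K)
  finally have "(\<Sum>a\<le>2 * K + 2. \<Sum>i\<le>K. SS (int a) * cur (1 - int a + int i) (e i))
      = fps_nth (W * ?\<Omega>) k + fps_nth (of_nat k * beta j ^ (k - 1) * H * (fps_const (B0 j) + fps_const (A0 j) * YF 2)) k"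
    by (simp add: distrib_left)
  also have "fps_nth (W * ?\<Omega>) k
      = fps_nth (W * (fps_deriv L - fps_X * fps_deriv (YF 2) - fps_X * (YF 2 * fps_deriv L))) k"
    unfolding L_def by (rule fps_mult_nth_cong, rule Lam_fps_identity[of k]) (simp_all add: K)
  also have "\<dots> + fps_nth (of_nat k * beta j ^ (k - 1) * H * (fps_const (B0 j) + fps_const (A0 j) * YF 2)) k
      = fps_nth (fps_deriv W + of_nat k * (W * YF 2) - fps_X * fps_deriv (W * YF 2)) k"
  proof -
    \<comment> \<open>Replacing A0 by beta - s B0 restores beta^k from beta^(k-1); what remains is
      the part of W' in which beta is differentiated.\<close>
    have A: "fps_const (A0 j) = beta j - fps_const (B0 j) * fps_X"
      by (simp add: beta_def)
    have B: "fps_deriv (beta j) = fps_const (B0 j)"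
      by (simp add: beta_def)
    have dW: "fps_deriv W = of_nat k * beta j ^ (k - 1) * fps_const (B0 j) * H + W * fps_deriv L"
      by (simp add: W_def L_def fps_deriv_power B deriv_H fps_of_nat algebra_simps)
    have pow: "of_nat k * beta j ^ (k - 1) * beta j = of_nat k * beta j ^ k"
      by (cases k) simp_all
    have "of_nat k * beta j ^ (k - 1) * H * (fps_const (B0 j) + fps_const (A0 j) * YF 2)
        = of_nat k * beta j ^ (k - 1) * fps_const (B0 j) * H + (of_nat k * beta j ^ (k - 1) * beta j) * H * YF 2
          - fps_X * (YF 2 * (of_nat k * beta j ^ (k - 1) * fps_const (B0 j) * H))"
      unfolding A by (simp only: algebra_simps)
    also have "\<dots> = fps_deriv W - W * fps_deriv L + of_nat k * (W * YF 2)
        - fps_X * (YF 2 * (fps_deriv W - W * fps_deriv L))"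
      unfolding pow dW by (simp add: W_def mult.assoc)
    finally have E: "of_nat k * beta j ^ (k - 1) * H * (fps_const (B0 j) + fps_const (A0 j) * YF 2)
        = fps_deriv W - W * fps_deriv L + of_nat k * (W * YF 2) - fps_X * (YF 2 * (fps_deriv W - W * fps_deriv L))" .
    have "W * (fps_deriv L - fps_X * fps_deriv (YF 2) - fps_X * (YF 2 * fps_deriv L))
        + (fps_deriv W - W * fps_deriv L + of_nat k * (W * YF 2) - fps_X * (YF 2 * (fps_deriv W - W * fps_deriv L)))
        = fps_deriv W + of_nat k * (W * YF 2) - fps_X * fps_deriv (W * YF 2)"
      by (simp add: algebra_simps)
    then show ?thesis
      unfolding fps_add_nth[symmetric] E by (simp only:)
  qed
  \<comment> \<open>The correction \<open>k W YF\<^sub>2 - s (W YF\<^sub>2)'\<close> to \<open>W'\<close> has no coefficient at $s^k$.\<close>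
  also have "\<dots> = of_nat (Suc k) * fps_nth W (Suc k)"
  proof -
    have "fps_nth (fps_X * fps_deriv F) k = of_nat k * fps_nth F k" for F :: "mps fps"
      by (cases k) (simp_all del: of_nat_Suc)
    then show ?thesis
      by (simp only: fps_add_nth fps_sub_nth fps_of_nat_mult_nth) simp
  qed
  finally show ?thesis
    by (simp add: e_def W_def)
qed

lemma oppow_scale:
  assumes "\<And>l c f. A l (mps_const c * f) = mps_const c * A l f"
  shows "oppow A m i (mps_const c * f) = mps_const c * oppow A m i f"
  by (induction m arbitrary: i) (simp_all add: assms sum_distrib_left)

lemma opexp_ann_scale: "opexp (ann \<sigma>) i (mps_const c * f) = mps_const c * opexp (ann \<sigma>) i f"
  unfolding opexp_def
  by (subst oppow_scale)
    (simp_all add: ann_def derivation_const_mult[OF derivation_dd] sum_distrib_left mult.left_commute)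

lemma cur_scale: "cur b (mps_const c * f) = mps_const c * cur b f"
  by (simp add: cur_def derivation_const_mult[OF derivation_dx] mult.left_commute)

text \<open>By \<open>T_svec\<close> below, this is $(\varphi_{-j}\varphi^*_{-1})^k \cdot 1 / k!$.\<close>

definition svec :: "nat \<Rightarrow> nat \<Rightarrow> mps" where
  "svec j k = fps_nth (beta j ^ k * H) k"

lemma phi_star_svec:
  assumes j: "j \<ge> 1"
  shows "phi_star (- 1) (of_mps (mps_const c * svec j k))
    = (\<lambda>n. if n = 1 then mps_const c * (of_nat (Suc k) * fps_nth (beta j ^ k * H) (Suc k)) else 0)"
proof (rule ext)
  fix n :: int
  let ?f = "of_mps (mps_const c * svec j k)"
  show "phi_star (- 1) ?f n
      = (if n = 1 then mps_const c * (of_nat (Suc k) * fps_nth (beta j ^ k * H) (Suc k)) else 0)"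
  proof (cases "n = 1")
    case True
    define K where "K = 2 * k + j + 2"
    have e: "opexp (ann (- 1)) i (?f (n - 1)) = mps_const c * fps_nth (beta j ^ k * H * pis i) k" for i
      using opexp_ann_minus_vector[OF dd_beta_power, of i j k k]
      by (simp add: True of_mps_def svec_def opexp_ann_scale ac_simps)
    have "phi_star (- 1) ?f n = (\<Sum>a\<le>2 * K + 2. \<Sum>i\<le>K. SS (int a) *
        cur (1 - int a + int i) (opexp (ann (- 1)) i (?f (n - 1))))"
    proof (rule phi_star_eq)
      fix i assume i: "i > K"
      have "fps_nth (beta j ^ k * H * pis i) k = fps_nth (beta j ^ k * H * 0) k"
        using i by (intro fps_mult_nth_cong) (simp add: pis_def pim_eq_0 K_def)
      then show "opexp (ann (- 1)) i (?f (n - 1)) = 0"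
        by (simp add: e)
    next
      fix i m assume "m > K"
      then show "dx m (opexp (ann (- 1)) i (?f (n - 1))) = 0"
        unfolding e by (simp add: derivation_const_mult[OF derivation_dx] dx_vector_eq_0 K_def)
    qed (use True in simp)
    also have "\<dots> = mps_const c * (\<Sum>a\<le>2 * K + 2. \<Sum>i\<le>K. SS (int a) *
        cur (1 - int a + int i) (fps_nth (beta j ^ k * H * pis i) k))"
      by (simp only: e cur_scale sum_distrib_left mult.left_commute)
    finally show ?thesis
      using True by (simp only: current_on_vector[OF j K_def] if_True simp_thms)
  next
    case False
    then have "?f (n - 1) = 0"
      by (simp add: of_mps_def)
    then show ?thesis
      using False by (subst phi_star_eq[where K = 0]) (simp_all add: opexp_0_right derivation_0[OF derivation_dx])
  qed
qed

text \<open>The inverse factor 1 - s Q(1/z) has degree 2 in 1/z, so three Schur polynomials survive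
  and assemble \<open>beta\<close>. The index \<open>l\<close> is free because each s-coefficient is
  translated separately; it is used at k + 1.\<close>

lemma phi_svec:
  assumes j: "j \<ge> 1"
  shows "phi (- int j) (\<lambda>n. if n = 1 then mps_const c * fps_nth (beta j ^ k * H) l else 0)
    = of_mps (mps_const c * fps_nth (beta j ^ Suc k * H) l)"
proof (rule ext)
  fix n :: int
  let ?f = "\<lambda>n :: int. if n = 1 then mps_const c * fps_nth (beta j ^ k * H) l else 0"
  show "phi (- int j) ?f n = of_mps (mps_const c * fps_nth (beta j ^ Suc k * H) l) n"
  proof (cases "n = 0")
    case True
    have e: "opexp (ann 1) i (?f (n + 1)) = mps_const c * fps_nth (beta j ^ k * H * pis_inv i) l" for i
      using opexp_ann_plus_vector[OF dd_beta_power, of i j k l]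
      by (simp add: True opexp_ann_scale ac_simps)
    have Q: "fps_nth Q i = (if i = 1 then - u1 else if i = 2 then - 1 else 0)" for i
      using pim_Suc[of 0 i] by (auto simp: pim_def)
    have zero: "pis_inv i = 0" if "i > 2" for i
      using that by (simp add: pis_inv_def Q)
    have "phi (- int j) ?f n = (\<Sum>i\<le>2. SM (int j - 1 + int i) * opexp (ann 1) i (?f (n + 1)))"
      by (rule phi_eq) (simp only: e zero, simp)
    also have "\<dots> = mps_const c * fps_nth (beta j ^ k * H * (\<Sum>i\<le>2. fps_const (SM (int j - 1 + int i)) * pis_inv i)) l"
      by (simp only: e sum_distrib_left fps_sum_nth mult.left_commute[of "_ * H"] fps_mult_left_const_nth
          mult.left_commute[of _ "mps_const c"])
    also have "(\<Sum>i\<le>2. fps_const (SM (int j - 1 + int i)) * pis_inv i) = beta j"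
    proof -
      have "(\<Sum>i\<le>2. fps_const (SM (int j - 1 + int i)) * pis_inv i)
          = fps_const (SM (int j - 1)) * 1 + fps_const (SM (int j)) * (fps_const u1 * fps_X)
            + fps_const (SM (int j + 1)) * fps_X"
        by (simp add: numeral_2_eq_2 pis_inv_def Q fps_const_neg[symmetric] add.commute[of 1 "int j"]
            del: fps_const_neg fps_const_mult)
      then show ?thesis
        by (simp add: beta_def A0_def B0_def algebra_simps flip: fps_const_add fps_const_mult)
    qed
    finally show ?thesis
      using True by (simp add: of_mps_def ac_simps)
  next
    case False
    then show ?thesis
      by (subst phi_eq[where K = 0]) (simp_all add: opexp_0_right of_mps_def)
  qed
qed

text \<open>phi_star raises the power of s and contributes the factor m + 1, then phi raises the
  power of beta, so the two exponents agree again after each round.\<close>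

lemma T_svec:
  assumes j: "j \<ge> 1"
  shows "((\<lambda>f. fmult (mps_const a) (phi (- int j) (phi_star (- 1) f))) ^^ m) vac
    = of_mps (mps_const (fact m * a ^ m) * svec j m)"
proof (induction m)
  case 0
  show ?case
    by (simp add: vac_def svec_def)
next
  case (Suc m)
  let ?T = "\<lambda>f. fmult (mps_const a) (phi (- int j) (phi_star (- 1) f))"
  let ?c = "fact m * a ^ m * of_nat (Suc m)"
  have c: "mps_const (fact m * a ^ m) * (of_nat (Suc m) * x) = mps_const ?c * x" for x
    by (simp only: mps_const_of_nat[symmetric] mps_const_mult mult.assoc)
  have "(?T ^^ Suc m) vac = ?T (of_mps (mps_const (fact m * a ^ m) * svec j m))"
    using Suc by simp
  also have "\<dots> = fmult (mps_const a) (of_mps (mps_const ?c * fps_nth (beta j ^ Suc m * H) (Suc m)))"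
    by (simp only: phi_star_svec[OF j] c phi_svec[OF j])
  also have "\<dots> = of_mps (mps_const (a * ?c) * svec j (Suc m))"
    by (rule ext) (simp add: fmult_def of_mps_def svec_def mps_const_mult mult.assoc del: power_Suc)
  also have "a * ?c = fact (Suc m) * a ^ Suc m"
    by (simp add: algebra_simps)
  finally show ?case .
qed

section \<open>Summation\<close>

lemma ord_ge_uv: "ord_ge n (uv n)" if "n \<ge> 1"
  using that by (simp add: uv_def ord_ge_add ord_ge_xv ord_ge_yv)

lemma ord_ge_SM: "ord_ge n (SM (int n))"
proof -
  let ?T = "tser (\<lambda>n. - uv n)"
  have "filtered ?T"
    by (auto simp: filtered_def ord_ge_uv ord_ge_uminus)
  then have "filtered (expS (fps_nth ?T))"
    by (rule filtered_expS) simp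
  moreover have "tser (fps_nth ?T) = ?T"
    by (rule fps_ext) simp
  then have "schur k (fps_nth ?T) = schur k (\<lambda>n. - uv n)" for k
    by (simp add: schur_def)
  ultimately show ?thesis
    by (simp add: filtered_def expS_def SM_def)
qed

text \<open>Both Schur indices are positive. This makes the geometric series for the inverse of 1 -
  a B0 converge coefficientwise.\<close>

lemma ord_ge_B0:
  assumes "j \<ge> 1"
  shows "ord_ge 1 (B0 j)"
proof -
  have "ord_ge 1 (SM (int j))" "ord_ge 1 (SM (int (j + 1)))"
    using assms ord_ge_mono[OF ord_ge_SM[of j], of 1] ord_ge_mono[OF ord_ge_SM[of "j + 1"], of 1] by simp_all
  then show ?thesis
    unfolding B0_def by (intro ord_ge_add ord_ge_mult_left) (simp_all add: add.commute)
qed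

lemma ord_ge_Lam: "ord_ge n (Lam n)"
  unfolding Lam_def
proof (rule ord_ge_uminus, rule ord_ge_mult_left, rule ord_ge_sum)
  fix m assume "m \<in> {1..2*n}"
  then show "ord_ge n (pim n m * (of_nat m * xv m))"
    by (cases "m < n") (auto simp: pim_eq_0_low intro!: ord_ge_mult_left ord_ge_mono[OF ord_ge_xv])
qed

lemma eval1_const_X_power:
  assumes "ord_ge k c"
  shows "filtered (fps_const c * fps_X ^ k)" "eval1 (fps_const c * fps_X ^ k) = c"
proof -
  show filt: "filtered (fps_const c * fps_X ^ k)"
    using assms by (simp add: filtered_def fps_X_power_nth)
  show "eval1 (fps_const c * fps_X ^ k) = c"
  proof (rule mps_eqI)
    fix m
    have "mps_coeff (eval1 (fps_const c * fps_X ^ k)) m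
        = (\<Sum>i\<le>weight m + k. mps_coeff (fps_nth (fps_const c * fps_X ^ k) i) m)"
      by (rule eval1_bound[OF filt]) simp
    also have "\<dots> = (\<Sum>i\<le>weight m + k. if i = k then mps_coeff c m else 0)"
      by (rule sum.cong) (auto simp: fps_X_power_nth zero_mps.rep_eq)
    finally show "mps_coeff (eval1 (fps_const c * fps_X ^ k)) m = mps_coeff c m"
      by simp
  qed
qed

lemma geometric_power_nth:
  fixes b :: mps
  shows "fps_nth (Abs_fps (\<lambda>r. b ^ r) ^ Suc k) r = of_nat ((k + r) choose k) * b ^ r"
proof (induction k arbitrary: r)
  case (Suc k)
  have "fps_nth (Abs_fps (\<lambda>r. b ^ r) ^ Suc (Suc k)) r
      = (\<Sum>i=0..r. of_nat ((k + i) choose k) * b ^ i * b ^ (r - i))"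
    by (simp add: power_Suc2[of _ "Suc k"] fps_mult_nth Suc del: power_Suc)
  also have "\<dots> = (\<Sum>i=0..r. of_nat ((k + i) choose k) * b ^ r)"
    by (rule sum.cong) (auto simp: mult.assoc simp flip: power_add)
  also have "\<dots> = of_nat (\<Sum>i=0..r. (k + i) choose k) * b ^ r"
    by (simp add: sum_distrib_right)
  also have "(\<Sum>i=0..r. (k + i) choose k) = (Suc k + r) choose Suc k"
    using choose_rising_sum(1)[of k r] by (simp add: atMost_atLeast0 add.commute)
  finally show ?case .
qed simp

lemma beta_power_nth:
  assumes "i \<le> m"
  shows "fps_nth (beta j ^ m) i = of_nat (m choose i) * B0 j ^ i * A0 j ^ (m - i)"
proof -
  have "beta j ^ m = (\<Sum>k\<le>m. of_nat (m choose k) * (fps_const (B0 j) * fps_X) ^ k * fps_const (A0 j) ^ (m - k))"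
    unfolding beta_def by (subst add.commute) (rule binomial_ring)
  also have "\<dots> = (\<Sum>k\<le>m. fps_const (of_nat (m choose k) * B0 j ^ k * A0 j ^ (m - k)) * fps_X ^ k)"
    by (simp add: power_mult_distrib fps_const_power ac_simps flip: fps_of_nat fps_const_mult)
  also have "fps_nth \<dots> i = (\<Sum>k\<le>m. if k = i then of_nat (m choose i) * B0 j ^ i * A0 j ^ (m - i) else 0)"
    unfolding fps_sum_nth by (rule sum.cong) (auto simp: fps_X_power_nth)
  finally show ?thesis
    using assms by simp
qed

text \<open>The substitution of q w for w in exp(sum t_n w^n).\<close>

lemma schur_rescale: "schur k (\<lambda>n. t n * q ^ n) = schur k t * q ^ k"
proof -
  have "fps_nth (tser (\<lambda>n. t n * q ^ n) ^ m) k = fps_nth (tser t ^ m) k * q ^ k" for m k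
  proof (induction m arbitrary: k)
    case (Suc m)
    let ?t = "\<lambda>n. t n * q ^ n"
    have "fps_nth (tser ?t ^ Suc m) k = (\<Sum>i=0..k. fps_nth (tser ?t) i * (fps_nth (tser t ^ m) (k - i) * q ^ (k - i)))"
      by (simp only: power_Suc fps_mult_nth[of "tser ?t"] Suc.IH)
    also have "\<dots> = (\<Sum>i=0..k. fps_nth (tser t) i * fps_nth (tser t ^ m) (k - i) * q ^ k)"
    proof (rule sum.cong)
      fix i assume "i \<in> {0..k}"
      then have "q ^ k = q ^ i * q ^ (k - i)"
        by (simp flip: power_add)
      then show "fps_nth (tser ?t) i * (fps_nth (tser t ^ m) (k - i) * q ^ (k - i))
          = fps_nth (tser t) i * fps_nth (tser t ^ m) (k - i) * q ^ k"
        by (cases "i = 0") (simp_all only: fps_nth_Abs_fps if_True if_False simp_thms mult_zero_left ac_simps)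
    qed simp
    also have "\<dots> = fps_nth (tser t ^ Suc m) k * q ^ k"
      by (simp only: power_Suc fps_mult_nth[of "tser t"] sum_distrib_right)
    finally show ?case .
  qed simp
  then show ?thesis
    by (simp add: schur_def sum_distrib_right mult.assoc)
qed

text \<open>Binomial theorem for Q^n = (-1)^n v^n (u_1 + v)^n, with the sign absorbed into (-
  q)^n.\<close>

lemma Lam_explicit:
  assumes "n \<ge> 1"
  shows "- (Lam n * q ^ n) = (\<Sum>i\<le>n. mps_const (of_nat (n choose i) / of_nat n) * u1 ^ (n - i)
    * (of_nat (n + i) * xv (n + i)) * (- q) ^ n)"
proof -
  have pim: "pim n (n + i) = (- 1) ^ n * of_nat (n choose i) * u1 ^ (n - i)" if "i \<le> n" for i
  proof -
    have "Q = fps_const (- 1) * (fps_X * (fps_X + fps_const u1))"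
      by (simp add: Q_def power2_eq_square algebra_simps flip: fps_const_neg)
    from arg_cong[OF this, of "\<lambda>f. f ^ n"]
    have "Q ^ n = fps_const ((- 1) ^ n) * (fps_X ^ n * (fps_X + fps_const u1) ^ n)"
      unfolding power_mult_distrib fps_const_power .
    then have "pim n (n + i) = (- 1) ^ n * fps_nth ((fps_X + fps_const u1) ^ n) i"
      by (simp add: pim_def fps_X_power_mult_nth)
    also have "(fps_X + fps_const u1) ^ n = (\<Sum>k\<le>n. fps_const (of_nat (n choose k) * u1 ^ (n - k)) * fps_X ^ k)"
      unfolding binomial_ring
      by (simp add: fps_const_power ac_simps flip: fps_of_nat fps_const_mult)
    also have "fps_nth \<dots> i = (\<Sum>k\<le>n. if k = i then of_nat (n choose i) * u1 ^ (n - i) else 0)"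
      unfolding fps_sum_nth by (rule sum.cong) (auto simp: fps_X_power_nth)
    finally show ?thesis
      using that by (simp add: mult.assoc)
  qed
  have "- Lam n = mps_const (1 / of_nat n) * (\<Sum>m=n..n+n. pim n m * (of_nat m * xv m))"
    unfolding Lam_def using assms
    by (simp, intro arg_cong2[where f = "(*)"] refl sum.mono_neutral_right) (auto simp: pim_eq_0_low)
  also have "(\<Sum>m=n..n+n. pim n m * (of_nat m * xv m)) = (\<Sum>i\<le>n. pim n (n + i) * (of_nat (n + i) * xv (n + i)))"
    by (rule sum.reindex_bij_witness[where i = "\<lambda>i. n + i" and j = "\<lambda>m. m - n"]) auto
  finally have "- (Lam n * q ^ n) = (\<Sum>i\<le>n. mps_const (1 / of_nat n) * (pim n (n + i) * (of_nat (n + i) * xv (n + i))) * q ^ n)"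
    by (simp only: mult_minus_left[symmetric] sum_distrib_left sum_distrib_right)
  also have "\<dots> = (\<Sum>i\<le>n. mps_const (of_nat (n choose i) / of_nat n) * u1 ^ (n - i)
    * (of_nat (n + i) * xv (n + i)) * (- q) ^ n)"
  proof (rule sum.cong)
    fix i assume "i \<in> {..n}"
    have "mps_const (of_nat (n choose i) / of_nat n) = mps_const (1 / of_nat n) * of_nat (n choose i)"
      unfolding mps_const_of_nat[symmetric] mps_const_mult[symmetric] by simp
    moreover have "(- q) ^ n = (- 1) ^ n * q ^ n"
      by (rule power_minus)
    ultimately show "mps_const (1 / of_nat n) * (pim n (n + i) * (of_nat (n + i) * xv (n + i))) * q ^ n
        = mps_const (of_nat (n choose i) / of_nat n) * u1 ^ (n - i) * (of_nat (n + i) * xv (n + i)) * (- q) ^ n"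
      using pim[of i] \<open>i \<in> {..n}\<close> by (simp only: atMost_iff ac_simps)
  qed simp
  finally show ?thesis .
qed

lemma filtered_Lam: "filtered (Abs_fps (\<lambda>n. Lam n * q ^ n))"
  by (simp add: filtered_def ord_ge_mult_right ord_ge_Lam)

text \<open>The value of H at s = q. It exists for every q, even with a constant term, because the
  weight comes from \<open>Lam n\<close>.\<close>

lemma mps_exp_Lam:
  "mps_exp (- (\<Sum>\<^sub>\<infinity>n\<in>{1..}. \<Sum>i\<le>n. mps_const (of_nat (n choose i) / of_nat n) * u1 ^ (n - i)
      * (of_nat (n + i) * xv (n + i)) * (- q) ^ n))
    = eval1 (Abs_fps (\<lambda>k. schur k Lam * q ^ k))"
  "filtered (Abs_fps (\<lambda>k. schur k Lam * q ^ k))"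
proof -
  define T where "T = Abs_fps (\<lambda>n. Lam n * q ^ n)"
  have T: "filtered T" "fps_nth T 0 = 0" "filtered (0 - T)"
    using filtered_Lam[of q] by (simp_all add: T_def filtered_def ord_ge_uminus)
  have "(\<Sum>\<^sub>\<infinity>n\<in>{1..}. \<Sum>i\<le>n. mps_const (of_nat (n choose i) / of_nat n) * u1 ^ (n - i)
      * (of_nat (n + i) * xv (n + i)) * (- q) ^ n) = infsum (fps_nth (0 - T)) {1..}"
    by (rule infsum_cong) (simp add: T_def Lam_explicit)
  also have "\<dots> = eval1 (0 - T)"
    by (rule infsumI, rule eval1_has_sum[OF T(3)]) (simp add: T(2))
  also have "\<dots> = - eval1 T"
    unfolding eval1_diff using eval1_const[of 0] by simp
  finally have "mps_exp (- (\<Sum>\<^sub>\<infinity>n\<in>{1..}. \<Sum>i\<le>n. mps_const (of_nat (n choose i) / of_nat n) * u1 ^ (n - i)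
      * (of_nat (n + i) * xv (n + i)) * (- q) ^ n)) = mps_exp (eval1 T)"
    by simp
  moreover have "expS (fps_nth T) = Abs_fps (\<lambda>k. schur k Lam * q ^ k)"
    by (rule fps_ext) (simp add: expS_def T_def schur_rescale Abs_fps_inverse)
  ultimately show "mps_exp (- (\<Sum>\<^sub>\<infinity>n\<in>{1..}. \<Sum>i\<le>n. mps_const (of_nat (n choose i) / of_nat n) * u1 ^ (n - i)
      * (of_nat (n + i) * xv (n + i)) * (- q) ^ n))
    = eval1 (Abs_fps (\<lambda>k. schur k Lam * q ^ k))"
    "filtered (Abs_fps (\<lambda>k. schur k Lam * q ^ k))"
    using mps_exp_eval1[OF T(1,2)] filtered_expS[OF T(1,2)] by simp_all
qed

lemma ord_ge_h: "ord_ge k (schur k Lam)"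
  using mps_exp_Lam(2)[of 1] by (simp add: filtered_def)

text \<open>Expanding beta^m gives the terms (m choose k) B0^(m-k) A0^k [s^k] H. With b = a B0, the
  sum of (m choose k) b^(m-k) over m is D^(-k-1), which leaves 1/D times H at a A0 / D.\<close>

lemma suminf_svec:
  fixes a :: complex and j :: nat
  defines "D \<equiv> 1 - mps_const a * B0 j"
  assumes j: "j \<ge> 1"
  shows "suminf (\<lambda>m. mps_const (a ^ m) * svec j m)
    = inverse D * eval1 (Abs_fps (\<lambda>k. schur k Lam * (mps_const a * A0 j * inverse D) ^ k))"
proof -
  define b where "b = mps_const a * B0 j"
  \<comment> \<open>Here \<open>fps_X\<close> records m. The weight k of the leading factor must
    come from \<open>schur k Lam\<close>, since A0 is 1 when j = 1.\<close>
  define G where "G k = fps_const (schur k Lam * (mps_const a * A0 j) ^ k) * fps_X ^ k * Abs_fps (\<lambda>r. b ^ r) ^ Suc k" for k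
  have b: "ord_ge 1 b"
    unfolding b_def by (rule ord_ge_mult_left) (rule ord_ge_B0[OF j])
  have geo: "filtered (Abs_fps (\<lambda>r. b ^ r))"
    using ord_ge_power[OF b] by (simp add: filtered_def)
  have "eval1 (Abs_fps (\<lambda>r. b ^ r)) * D = eval1 (Abs_fps (\<lambda>r. b ^ r)) * eval1 (1 - fps_const b * fps_X ^ 1)"
    using b by (simp only: eval1_diff eval1_const_X_power eval1_1 D_def b_def)
  also have "\<dots> = eval1 (Abs_fps (\<lambda>r. b ^ r) * (1 - fps_const b * fps_X ^ 1))"
  proof (rule eval1_mult[OF geo, symmetric])
    show "filtered (1 - fps_const b * fps_X ^ 1)"
      by (auto simp: filtered_def fps_X_nth intro!: ord_ge_uminus ord_ge_mono[OF b])
  qed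
  also have "Abs_fps (\<lambda>r. b ^ r) * (1 - fps_const b * fps_X ^ 1) = 1"
  proof (rule fps_ext)
    fix n
    have "Abs_fps (\<lambda>r. b ^ r) * (1 - fps_const b * fps_X ^ 1) = Abs_fps (\<lambda>r. b ^ r) - fps_const b * (fps_X * Abs_fps (\<lambda>r. b ^ r))"
      by (simp add: algebra_simps)
    then show "fps_nth (Abs_fps (\<lambda>r. b ^ r) * (1 - fps_const b * fps_X ^ 1)) n = fps_nth 1 n"
      by (cases n) simp_all
  qed
  finally have inv: "inverse D = eval1 (Abs_fps (\<lambda>r. b ^ r))"
    by (intro mps_inverse_unique) (simp add: mult.commute)
  have ord: "ord_ge k (schur k Lam * (mps_const a * A0 j) ^ k)" for k
    by (intro ord_ge_mult_right ord_ge_h)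
  have filt: "filtered (G k)" for k
    unfolding G_def by (intro filtered_mult filtered_power geo eval1_const_X_power(1) ord)
  have G_nth: "fps_nth (G k) m = (if m < k then 0 else
      schur k Lam * (mps_const a * A0 j) ^ k * (of_nat (m choose k) * b ^ (m - k)))" for k m
  proof -
    have "fps_nth (G k) m = schur k Lam * (mps_const a * A0 j) ^ k *
        fps_nth (fps_X ^ k * Abs_fps (\<lambda>r. b ^ r) ^ Suc k) m"
      unfolding G_def mult.assoc by (simp only: fps_mult_left_const_nth mult.assoc)
    then show ?thesis
      unfolding fps_X_power_mult_nth geometric_power_nth by simp
  qed
  have low: "fps_nth (G k) i = 0" if "i < k" for k i
    using that by (simp add: G_nth)
  have eval_G: "eval1 (G k) = inverse D * (schur k Lam * (mps_const a * A0 j * inverse D) ^ k)" for k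
  proof -
    have "eval1 (G k) = schur k Lam * (mps_const a * A0 j) ^ k * inverse D ^ Suc k"
      unfolding G_def inv using geo ord
      by (subst eval1_mult) (simp_all only: eval1_const_X_power eval1_power filtered_power)
    then show ?thesis
      by (simp add: power_mult_distrib ac_simps)
  qed
  have "mps_const (a ^ m) * svec j m = (\<Sum>k\<le>m. fps_nth (G k) m)" for m
  proof -
    have "mps_const (a ^ m) * svec j m = (\<Sum>i\<le>m. mps_const a ^ m * (fps_nth (beta j ^ m) i * schur (m - i) Lam))"
      by (simp add: svec_def fps_mult_nth H_def expS_def sum_distrib_left mps_const_power atMost_atLeast0)
    also have "\<dots> = (\<Sum>k\<le>m. mps_const a ^ m * (fps_nth (beta j ^ m) (m - k) * schur k Lam))"
      by (rule sum.reindex_bij_witness[where i = "\<lambda>k. m - k" and j = "\<lambda>k. m - k"]) auto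
    also have "\<dots> = (\<Sum>k\<le>m. fps_nth (G k) m)"
    proof (rule sum.cong)
      fix k assume k: "k \<in> {..m}"
      then have "mps_const a ^ m = mps_const a ^ k * mps_const a ^ (m - k)"
        by (simp flip: power_add)
      moreover have "fps_nth (beta j ^ m) (m - k) = of_nat (m choose k) * B0 j ^ (m - k) * A0 j ^ k"
        using k by (simp add: beta_power_nth binomial_symmetric[of k m])
      ultimately show "mps_const a ^ m * (fps_nth (beta j ^ m) (m - k) * schur k Lam) = fps_nth (G k) m"
        using k by (simp add: G_nth b_def power_mult_distrib ac_simps)
    qed simp
    finally show ?thesis .
  qed
  then have "suminf (\<lambda>m. mps_const (a ^ m) * svec j m) = suminf (fps_nth (Abs_fps (\<lambda>m. \<Sum>k\<le>m. fps_nth (G k) m)))"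
    by (simp add: Abs_fps_inverse)
  also have "\<dots> = eval1 (Abs_fps (\<lambda>m. \<Sum>k\<le>m. fps_nth (G k) m))"
    by (rule sums_unique[symmetric], rule eval1_sums, rule filtered_diagonal[OF filt low])
  also have "\<dots> = eval1 (Abs_fps (\<lambda>k. eval1 (G k)))"
    by (rule eval1_diagonal[OF filt low])
  also have "Abs_fps (\<lambda>k. eval1 (G k))
      = fps_const (inverse D) * Abs_fps (\<lambda>k. schur k Lam * (mps_const a * A0 j * inverse D) ^ k)"
    by (rule fps_ext) (simp add: eval_G)
  finally show ?thesis
    by (simp only: eval1_mult[OF filtered_const mps_exp_Lam(2)] eval1_const)
qed

theorem theorem3p2:
  fixes j :: nat and a :: complex and D :: mps and Sp Sm :: "nat \<Rightarrow> mps"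
  defines "Sp \<equiv> (\<lambda>k. schur k (\<lambda>n. xv n + yv n))"
    and "Sm \<equiv> (\<lambda>k. schur k (\<lambda>n. - xv n - yv n))"
    and "D \<equiv> 1 - mps_const a * Sm (j + 1) - mps_const a * Sp 1 * Sm j"
  assumes "j \<ge> 1"
  shows "op_exp (\<lambda>f. fmult (mps_const a) (phi (- int j) (phi_star (- 1) f))) vac =
    of_mps (1 / D * mps_exp (- (\<Sum>\<^sub>\<infinity>n\<in>{1..}. \<Sum>i\<le>n.
      mps_const (of_nat (n choose i) / of_nat n) * Sp 1 ^ (n - i) * (of_nat (n + i) * xv (n + i))
        * (- mps_const a * Sm (j - 1) / D) ^ n)))"
proof -
  let ?q = "mps_const a * A0 j * inverse D"
  have Sm: "Sm k = SM (int k)" for k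
    by (simp add: Sm_def SM_def uv_def)
  have Sp: "Sp 1 = u1"
    by (simp add: Sp_def schur_1 u1_def uv_def)
  have D: "D = 1 - mps_const a * B0 j"
    unfolding D_def Sm Sp B0_def by (simp add: algebra_simps)
  have A: "Sm (j - 1) = A0 j"
    using \<open>j \<ge> 1\<close> by (simp add: Sm A0_def of_nat_diff)
  have q: "- mps_const a * Sm (j - 1) / D = - ?q"
    unfolding A by (simp add: divide_mps_def)
  have "op_exp (\<lambda>f. fmult (mps_const a) (phi (- int j) (phi_star (- 1) f))) vac
      = of_mps (suminf (\<lambda>m. mps_const (a ^ m) * svec j m))"
  proof (rule ext)
    fix n :: int
    have c: "mps_const (1 / fact m) * (mps_const (fact m * a ^ m) * x) = mps_const (a ^ m) * x" for m x
      by (simp add: mult.assoc[symmetric] flip: mps_const_mult)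
    show "op_exp (\<lambda>f. fmult (mps_const a) (phi (- int j) (phi_star (- 1) f))) vac n
        = of_mps (suminf (\<lambda>m. mps_const (a ^ m) * svec j m)) n"
      unfolding op_exp_def T_svec[OF \<open>j \<ge> 1\<close>] by (simp add: of_mps_def c)
  qed
  also have "suminf (\<lambda>m. mps_const (a ^ m) * svec j m)
      = inverse D * eval1 (Abs_fps (\<lambda>k. schur k Lam * ?q ^ k))"
    unfolding D by (rule suminf_svec[OF \<open>j \<ge> 1\<close>])
  also have "\<dots> = 1 / D * mps_exp (- (\<Sum>\<^sub>\<infinity>n\<in>{1..}. \<Sum>i\<le>n.
      mps_const (of_nat (n choose i) / of_nat n) * Sp 1 ^ (n - i) * (of_nat (n + i) * xv (n + i))
        * (- mps_const a * Sm (j - 1) / D) ^ n))"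
    unfolding q Sp mps_exp_Lam(1) by (simp add: divide_mps_def)
  finally show ?thesis .
qed

end
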